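(* For every $m\in\mathbb{Q}_{>0}$ there exists a unique $\mathbb{Q}[\mu]$-linear map $\zeta^{\mu,T}_{\sqcup\!\sqcup,m}:\mathbb{Q}[\mu]\langle X^\mu\rangle^1\to\mathcal{Z}^{\mu}[T]$ such that (i) $\zeta^{\mu,T}_{\sqcup\!\sqcup,m}(w)=\zeta^{\mu}_{\sqcup\!\sqcup}(w)$ for all $w\in\mathbb{Q}[\mu]\langle X^\mu\rangle^0$; (ii) $\zeta^{\mu,T}_{\sqcup\!\sqcup,m}(y^\mu_{m})=T$; (iii) $\zeta^{\mu,T}_{\sqcup\!\sqcup,m}(v\sqcup\!\sqcup w)=\zeta^{\mu,T}_{\sqcup\!\sqcup,m}(v)\cdot\zeta^{\mu,T}_{\sqcup\!\sqcup,m}(w)$ for all $v,w\in\mathbb{Q}[\mu]\langle X^\mu\rangle^1$.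
   Context: Fix $\mu\in\mathbb{C}$ with $\mathrm{Re}(\mu)>0$; $\mathbb{Q}[\mu]\subset\mathbb{C}$ is the ring generated by $\mu$. A bi-index $(\mathbf{k};\mathbf{m})=(k_1,\dots,k_r;m_1,\dots,m_r)\in\mathbb{N}^r\times\mathbb{Q}^r$ is positive if all $m_i>0$, admissible if positive and $k_r>1$. For admissible ones $\zeta^{\mu}(\mathbf{k};\mathbf{m})=\sum_{0\le n_1\le\cdots\le n_r}\mu^r\prod_i(n_i\mu+m_i)^{-k_i}$ ($\zeta^\mu(\emptyset)=1$). A special triple $(\mathbf{k};\mathbf{m};\tilde{\mathbf{m}})$: $\mathbf{k}=(k_1,\dots,k_{r-1},1)$, $\mathbf{m}=(m_1,\dots,m_r)$, $\tilde{\mathbf{m}}=(m_1,\dots,m_{r-1},\tilde m_r)$, entries in $\mathbb{Q}_{>0}$, $m_r\neq\tilde m_r$; $\mathcal{D}^{\mu}(\mathbf{k};\mathbf{m};\tilde{\mathbf{m}})=(\tilde m_r-m_r)\sum_{0\le n_1\le\cdots\le n_r}\frac{\mu^r}{\prod_{i<r}(n_i\mu+m_i)^{k_i}(n_r\mu+m_r)(n_r\mu+\tilde m_r)}$. $\mathcal{Z}^\mu$ is the $\mathbb{Q}[\mu]$-span of $1$, all admissible $\zeta^\mu$ and all $\mathcal{D}^\mu$; it is a ring. Let $X^\mu=\{x\}\cup\{y^\mu_l:l\in\mathbb{Q}\}$ and $\mathbb{Q}[\mu]\langle X^\mu\rangle$ the free noncommutative $\mathbb{Q}[\mu]$-algebra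 on words over $X^\mu$. The shuffle product $\sqcup\!\sqcup$ is $\mathbb{Q}[\mu]$-bilinear with $1\sqcup\!\sqcup w=w\sqcup\!\sqcup1=w$ and $w_1u\sqcup\!\sqcup w_2v=(w_1\sqcup\!\sqcup w_2v)u+(w_1u\sqcup\!\sqcup w_2)v$ for letters $u,v$. For a positive bi-index put $(y,x)^\mu_{\mathbf{k};\mathbf{m}}=y^\mu_{m_1}x^{k_1-1}y^\mu_{m_2-m_1}x^{k_2-1}\cdots y^\mu_{m_r-m_{r-1}}x^{k_r-1}$. $\mathbb{Q}[\mu]\langle X^\mu\rangle^1$ is the $\mathbb{Q}[\mu]$-span of the words $y^\mu_{l_1}x^{t_1}\cdots y^\mu_{l_r}x^{t_r}$ ($r\ge0$, $t_i\ge0$) with $l_1+\dots+l_i>0$ for all $i$ (equivalently of $1$ and all $(y,x)^\mu_{\mathbf{k};\mathbf{m}}$, $(\mathbf{k};\mathbf{m})$ positive). $\mathbb{Q}[\mu]\langle X^\mu\rangle^0$ is the $\mathbb{Q}[\mu]$-span of $1$, the admissible words $(y,x)^\mu_{\mathbf{k};\mathbf{m}}$ ($(\mathbf{k};\mathbf{m})$ admissible) and the quasi-admissible elements $(y,x)^\mu_{\mathbf{k};\mathbf{m}}-(y,x)^\mu_{\mathbf{k};\tilde{\mathbf{m}}}$ (special triples). $\zeta^\mu_{\sqcup\!\sqcup}:\mathbb{Q}[\mu]\langle X^\mu\rangle^0\to\mathcal{Z}^\mu$ is the $\mathbb{Q}[\mu]$-linear map with $1\mapsto1$, $(y,x)^\mu_{\mathbf{k};\mathbf{m}}\mapsto\zeta^\mu(\mathbf{k};\mathbf{m})$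 for admissible $(\mathbf{k};\mathbf{m})$, and $(y,x)^\mu_{\mathbf{k};\mathbf{m}}-(y,x)^\mu_{\mathbf{k};\tilde{\mathbf{m}}}\mapsto\mathcal{D}^\mu(\mathbf{k};\mathbf{m};\tilde{\mathbf{m}})$. *)

theory Defs
  imports
    "HOL-Analysis.Analysis"
    "HOL-Library.Poly_Mapping"
    "HOL-Library.FuncSet"
    "HOL-Computational_Algebra.Polynomial"
begin

definition rat_adjoin :: "complex \<Rightarrow> complex set" where
  "rat_adjoin \<mu> = range (\<lambda>p :: rat poly. poly (map_poly of_rat p) \<mu>)"

text \<open>Span and linearity over a set \<open>R\<close> of complex scalars, since the coefficient ring
  \<open>\<rat>[\<mu>]\<close> is a subset of the complex numbers rather than a type.\<close>

definition span_over ::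
    "complex set \<Rightarrow> (complex \<Rightarrow> 'a \<Rightarrow> 'a) \<Rightarrow> 'a set \<Rightarrow> 'a::comm_monoid_add set" where
  "span_over R sc S =
     {\<Sum>v\<in>F. sc (a v) v | F a. finite F \<and> F \<subseteq> S \<and> (\<forall>v\<in>F. a v \<in> R)}"

definition linear_over ::
    "complex set \<Rightarrow> (complex \<Rightarrow> 'a \<Rightarrow> 'a) \<Rightarrow> (complex \<Rightarrow> 'b \<Rightarrow> 'b) \<Rightarrow>
     'a::comm_monoid_add set \<Rightarrow> ('a \<Rightarrow> 'b::comm_monoid_add) \<Rightarrow> bool" where
  "linear_over R sc1 sc2 V f \<longleftrightarrow>
     (\<forall>v\<in>V. \<forall>w\<in>V. f (v + w) = f v + f w) \<and>
     (\<forall>c\<in>R. \<forall>v\<in>V. f (sc1 c v) = sc2 c (f v))"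

definition positive_biindex :: "nat list \<Rightarrow> rat list \<Rightarrow> bool" where
  "positive_biindex ks ms \<longleftrightarrow>
     length ks = length ms \<and> (\<forall>k\<in>set ks. k \<ge> 1) \<and> (\<forall>m\<in>set ms. m > 0)"

definition admissible :: "nat list \<Rightarrow> rat list \<Rightarrow> bool" where
  "admissible ks ms \<longleftrightarrow> positive_biindex ks ms \<and> ks \<noteq> [] \<and> last ks > 1"

definition special_triple :: "nat list \<Rightarrow> rat list \<Rightarrow> rat list \<Rightarrow> bool" where
  "special_triple ks ms ms' \<longleftrightarrow>
     positive_biindex ks ms \<and> positive_biindex ks ms' \<and> ks \<noteq> [] \<and> last ks = 1 \<and>
     butlast ms = butlast ms' \<and> last ms \<noteq> last ms'"

definition weak_chains :: "nat \<Rightarrow> nat list set" where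
  "weak_chains r = {ns. length ns = r \<and> sorted ns}"

definition zeta_mu :: "complex \<Rightarrow> nat list \<Rightarrow> rat list \<Rightarrow> complex" where
  "zeta_mu \<mu> ks ms =
     (\<Sum>\<^sub>\<infinity>ns\<in>weak_chains (length ks).
        \<mu> ^ length ks / (\<Prod>i<length ks. (of_nat (ns ! i) * \<mu> + of_rat (ms ! i)) ^ (ks ! i)))"

definition D_mu :: "complex \<Rightarrow> nat list \<Rightarrow> rat list \<Rightarrow> rat list \<Rightarrow> complex" where
  "D_mu \<mu> ks ms ms' =
     of_rat (last ms' - last ms) *
     (\<Sum>\<^sub>\<infinity>ns\<in>weak_chains (length ks).
        \<mu> ^ length ks /
        ((\<Prod>i<length ks - 1. (of_nat (ns ! i) * \<mu> + of_rat (ms ! i)) ^ (ks ! i)) *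
         (of_nat (last ns) * \<mu> + of_rat (last ms)) *
         (of_nat (last ns) * \<mu> + of_rat (last ms'))))"

definition Z_mu :: "complex \<Rightarrow> complex set" where
  "Z_mu \<mu> = span_over (rat_adjoin \<mu>) (*)
     ({1} \<union> {zeta_mu \<mu> ks ms | ks ms. admissible ks ms}
          \<union> {D_mu \<mu> ks ms ms' | ks ms ms'. special_triple ks ms ms'})"

definition Z_mu_poly :: "complex \<Rightarrow> complex poly set" where
  "Z_mu_poly \<mu> = {p. \<forall>i. coeff p i \<in> Z_mu \<mu>}"

text \<open>\<open>Lx\<close> is the letter \<open>x\<close> and \<open>Ly l\<close> is \<open>y\<^sub>l\<close>. An element of the free algebra on words is
  the finitely supported function sending a word to its coefficient.\<close>

datatype letter = Lx | Ly rat

type_synonym word_comb = "letter list \<Rightarrow>\<^sub>0 complex"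

definition word :: "letter list \<Rightarrow> word_comb" where
  "word w = Poly_Mapping.single w 1"

definition scale_comb :: "complex \<Rightarrow> word_comb \<Rightarrow> word_comb" where
  "scale_comb c p = Poly_Mapping.map ((*) c) p"

definition lin_extend :: "(letter list \<Rightarrow> word_comb) \<Rightarrow> word_comb \<Rightarrow> word_comb" where
  "lin_extend f p = (\<Sum>w\<in>Poly_Mapping.keys p. scale_comb (Poly_Mapping.lookup p w) (f w))"

definition append_letter :: "word_comb \<Rightarrow> letter \<Rightarrow> word_comb" where
  "append_letter p u = lin_extend (\<lambda>w. word (w @ [u])) p"

function shuffle_words :: "letter list \<Rightarrow> letter list \<Rightarrow> word_comb" where
  "shuffle_words v w =
     (if v = [] then word w
      else if w = [] then word v
      else append_letter (shuffle_words (butlast v) w) (last v) +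
           append_letter (shuffle_words v (butlast w)) (last w))"
  by pat_completeness auto
termination
  by (relation "Wellfounded.measure (\<lambda>(v, w). length v + length w)") auto

declare shuffle_words.simps [simp del]

definition shuffle :: "word_comb \<Rightarrow> word_comb \<Rightarrow> word_comb" where
  "shuffle p q = lin_extend (\<lambda>v. lin_extend (\<lambda>w. shuffle_words v w) q) p"

text \<open>The first argument of \<open>yx_word_from\<close> is the preceding entry \<open>m\<^bsub>i-1\<^esub>\<close>, with \<open>m\<^sub>0 = 0\<close>.\<close>

fun yx_word_from :: "rat \<Rightarrow> nat list \<Rightarrow> rat list \<Rightarrow> letter list" where
  "yx_word_from m0 (k # ks) (m # ms) =
     Ly (m - m0) # replicate (k - 1) Lx @ yx_word_from m ks ms"
| "yx_word_from m0 _ _ = []"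

definition yx_word :: "nat list \<Rightarrow> rat list \<Rightarrow> word_comb" where
  "yx_word ks ms = word (yx_word_from 0 ks ms)"

definition words1 :: "letter list set" where
  "words1 = {concat (map (\<lambda>(l, t). Ly l # replicate t Lx) lts) | lts :: (rat \<times> nat) list.
     \<forall>i\<in>{1..length lts}. sum_list (map fst (take i lts)) > 0}"

definition H1 :: "complex \<Rightarrow> word_comb set" where
  "H1 \<mu> = span_over (rat_adjoin \<mu>) scale_comb (word ` words1)"

definition H0 :: "complex \<Rightarrow> word_comb set" where
  "H0 \<mu> = span_over (rat_adjoin \<mu>) scale_comb
     ({word []} \<union> {yx_word ks ms | ks ms. admissible ks ms}
        \<union> {yx_word ks ms - yx_word ks ms' | ks ms ms'. special_triple ks ms ms'})"

text \<open>The generators of \<open>H0\<close> are linearly dependent, but the conditions below are compatible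
  when \<open>Re \<mu> > 0\<close> and determine a unique map; extensionality fixes its value off \<open>H0\<close>.\<close>

definition zeta_sh :: "complex \<Rightarrow> word_comb \<Rightarrow> complex" where
  "zeta_sh \<mu> = (THE f. f \<in> H0 \<mu> \<rightarrow>\<^sub>E Z_mu \<mu> \<and>
     linear_over (rat_adjoin \<mu>) scale_comb (*) (H0 \<mu>) f \<and>
     f (word []) = 1 \<and>
     (\<forall>ks ms. admissible ks ms \<longrightarrow> f (yx_word ks ms) = zeta_mu \<mu> ks ms) \<and>
     (\<forall>ks ms ms'. special_triple ks ms ms' \<longrightarrow>
        f (yx_word ks ms - yx_word ks ms') = D_mu \<mu> ks ms ms'))"

end

theory Submission
  imports Defs
begin

text \<open>To every word we attach a power series in \<open>q\<close>, its polylogarithm, in such a way that shuffle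
  products become products of series. As \<open>q \<longrightarrow> 1\<close>, the series of the generators of \<open>H0\<close> converge to
  \<open>\<zeta>\<^sup>\<mu>\<close> and \<open>D\<^sup>\<mu>\<close> with an error that is negligible against all powers of the series \<open>L(q)\<close> of \<open>y\<^sub>m\<close>,
  while \<open>L(q) \<longrightarrow> \<infinity>\<close>. So an element \<open>p\<close> of \<open>H1\<close> has at most one polynomial \<open>P\<close> for which its series equals
  \<open>P(L(q))\<close> up to a negligible error, and the assignment \<open>p \<mapsto> P\<close> is automatically linear and
  multiplicative. It remains to see that \<open>H1\<close> is generated by \<open>H0\<close> under linear combinations and
  shuffles with \<open>y\<^sub>m\<close>: this provides \<open>P\<close> with coefficients in \<open>Z_mu\<close>, and uniqueness of the map. No
  freeness of \<open>H1\<close> over \<open>H0\<close> is needed, and multiplicativity of \<open>zeta_sh\<close> is a consequence.\<close>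

subsection \<open>The coefficient ring and spans over it\<close>

text \<open>An error term survives multiplication of two regularised values only if it stays small
  against every power of \<open>L(q)\<close>, so a bare limit at \<open>q = 1\<close> is too weak
  and rates are required. To get them, logarithms are traded for powers: truncated nested sums are
  bounded by a square root whatever the depth, the coefficients of admissible and quasi-admissible
  generators then decay with exponent -3/2, Abel's theorem follows with error of order
  \<open>(1 - q) powr (1/4)\<close>, and \<open>L(q)\<close> grows no faster than
  \<open>(1 - q) powr (- e)\<close> for arbitrarily small \<open>e > 0\<close>. That
  \<open>L\<close> is unbounded also for complex \<open>\<mu>\<close> is read off its real part. On
  the algebraic side, generation is an induction on the number of letters after the last
  \<open>x\<close>. The obstacle: the differences supplied by \<open>H0\<close> change only the very
  last letter, whereas letters further left have to be exchanged too. Shuffling with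
  \<open>y_m\<close> moves the exchange to the left, at the price of a division by an
  integer.\<close>

lemma poly_map_of_rat_add:
  "poly (map_poly of_rat (p + q)) z = poly (map_poly of_rat p) z + poly (map_poly of_rat q) (z :: complex)"
proof -
  have "map_poly of_rat (p + q) = map_poly of_rat p + (map_poly of_rat q :: complex poly)"
    by (rule poly_eqI) (simp add: coeff_map_poly of_rat_add)
  then show ?thesis by simp
qed

lemma poly_map_of_rat_mult:
  "poly (map_poly of_rat (p * q)) z = poly (map_poly of_rat p) z * poly (map_poly of_rat q) (z :: complex)"
proof (induction p)
  case (pCons a p)
  have "map_poly of_rat (smult a q) = smult (of_rat a) (map_poly of_rat q :: complex poly)"
    by (rule poly_eqI) (simp add: coeff_map_poly of_rat_mult)
  with pCons show ?case
    by (simp add: poly_map_of_rat_add map_poly_pCons algebra_simps)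
qed simp

lemma of_rat_in_rat_adjoin: "of_rat r \<in> rat_adjoin \<mu>"
  unfolding rat_adjoin_def
  by (rule image_eqI[of _ _ "[:r:]"]) (simp_all add: map_poly_pCons)

lemma rat_adjoin_add: "a \<in> rat_adjoin \<mu> \<Longrightarrow> b \<in> rat_adjoin \<mu> \<Longrightarrow> a + b \<in> rat_adjoin \<mu>"
  unfolding rat_adjoin_def by (force simp: poly_map_of_rat_add[symmetric])

lemma rat_adjoin_mult: "a \<in> rat_adjoin \<mu> \<Longrightarrow> b \<in> rat_adjoin \<mu> \<Longrightarrow> a * b \<in> rat_adjoin \<mu>"
  unfolding rat_adjoin_def by (force simp: poly_map_of_rat_mult[symmetric])

lemma rat_adjoin_simps [simp]:
  "0 \<in> rat_adjoin \<mu>" "1 \<in> rat_adjoin \<mu>" "- 1 \<in> rat_adjoin \<mu>" "of_nat n \<in> rat_adjoin \<mu>"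
  "inverse (of_nat n) \<in> rat_adjoin \<mu>"
  using of_rat_in_rat_adjoin[of 0 \<mu>] of_rat_in_rat_adjoin[of 1 \<mu>] of_rat_in_rat_adjoin[of "- 1" \<mu>]
    of_rat_in_rat_adjoin[of "of_nat n" \<mu>] of_rat_in_rat_adjoin[of "inverse (of_nat n)" \<mu>]
  by (simp_all add: of_rat_minus of_rat_inverse)

text \<open>Submodule conditions relative to a set of scalars. With \<open>span_over_least\<close>
  they act as an induction principle: a property holds on a span once its solution set is closed and
  contains the generators.\<close>

definition closed_over ::
    "complex set \<Rightarrow> (complex \<Rightarrow> 'a \<Rightarrow> 'a) \<Rightarrow> 'a::ab_group_add set \<Rightarrow> bool" where
  "closed_over R sc V \<longleftrightarrow> 0 \<in> V \<and> (\<forall>v\<in>V. \<forall>w\<in>V. v + w \<in> V) \<and> (\<forall>c\<in>R. \<forall>v\<in>V. sc c v \<in> V)"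

lemma closed_overD:
  assumes "closed_over R sc V"
  shows "0 \<in> V" "v \<in> V \<Longrightarrow> w \<in> V \<Longrightarrow> v + w \<in> V" "c \<in> R \<Longrightarrow> v \<in> V \<Longrightarrow> sc c v \<in> V"
  using assms by (auto simp: closed_over_def)

lemma closed_over_sum:
  assumes "closed_over R sc V" "\<And>x. x \<in> A \<Longrightarrow> f x \<in> V"
  shows "sum f A \<in> V"
  using assms(2) by (induction A rule: infinite_finite_induct) (auto intro: closed_overD[OF assms(1)])

lemma closed_over_diff:
  assumes "module sc" "- 1 \<in> R" "closed_over R sc V" "v \<in> V" "w \<in> V"
  shows "v - w \<in> V"
proof -
  have "sc (- 1) w = - w"
    using assms(1) by (simp add: module.scale_minus_left module.scale_one)
  with closed_overD(3)[OF assms(3,2,5)] have "- w \<in> V" by simp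
  with closed_overD(2)[OF assms(3,4)] show ?thesis by fastforce
qed

lemma span_over_least:
  assumes "closed_over R sc V" "S \<subseteq> V"
  shows "span_over R sc S \<subseteq> V"
  unfolding span_over_def
  using assms by (auto intro!: closed_over_sum[OF assms(1)] closed_overD(3)[OF assms(1)])

lemma span_over_superset:
  assumes "module sc" "1 \<in> R"
  shows "S \<subseteq> span_over R sc S"
proof
  fix v assume "v \<in> S"
  then have "v = (\<Sum>w\<in>{v}. sc 1 w) \<and> finite {v} \<and> {v} \<subseteq> S \<and> (\<forall>w\<in>{v}. (1 :: complex) \<in> R)"
    using assms by (simp add: module.scale_one)
  then show "v \<in> span_over R sc S"
    unfolding span_over_def by (intro CollectI exI[of _ "{v}"] exI[of _ "\<lambda>_. 1"]) simp
qed

lemma closed_over_span: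
  fixes sc :: "complex \<Rightarrow> 'a \<Rightarrow> 'a::ab_group_add"
  assumes "module sc" "0 \<in> R" "\<And>a b. a \<in> R \<Longrightarrow> b \<in> R \<Longrightarrow> a + b \<in> R"
    "\<And>a b. a \<in> R \<Longrightarrow> b \<in> R \<Longrightarrow> a * b \<in> R"
  shows "closed_over R sc (span_over R sc S)"
proof -
  interpret module sc by fact
  have spanI: "(\<Sum>v\<in>F. sc (a v) v) \<in> span_over R sc S"
    if "finite F" "F \<subseteq> S" "\<forall>v\<in>F. a v \<in> R" for F a
    using that unfolding span_over_def by blast
  show ?thesis
    unfolding closed_over_def
  proof (intro conjI ballI)
    show "0 \<in> span_over R sc S" using spanI[of "{}"] by simp
  next
    fix v w assume "v \<in> span_over R sc S" "w \<in> span_over R sc S"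
    then obtain F a G b where F: "finite F" "F \<subseteq> S" "\<forall>v\<in>F. a v \<in> R" "v = (\<Sum>v\<in>F. sc (a v) v)"
      and G: "finite G" "G \<subseteq> S" "\<forall>v\<in>G. b v \<in> R" "w = (\<Sum>v\<in>G. sc (b v) v)"
      unfolding span_over_def by blast
    let ?a = "\<lambda>v. if v \<in> F then a v else 0" and ?b = "\<lambda>v. if v \<in> G then b v else 0"
    have "v = (\<Sum>v\<in>F \<union> G. sc (?a v) v)"
      unfolding F(4) using F(1) G(1) by (intro sum.mono_neutral_cong_left) auto
    moreover have "w = (\<Sum>v\<in>F \<union> G. sc (?b v) v)"
      unfolding G(4) using F(1) G(1) by (intro sum.mono_neutral_cong_left) auto
    ultimately have "v + w = (\<Sum>v\<in>F \<union> G. sc (?a v + ?b v) v)"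
      by (simp add: scale_left_distrib sum.distrib)
    also have "\<dots> \<in> span_over R sc S"
      using F G assms(2,3) by (intro spanI) auto
    finally show "v + w \<in> span_over R sc S" .
  next
    fix c v assume "c \<in> R" "v \<in> span_over R sc S"
    then obtain F a where F: "finite F" "F \<subseteq> S" "\<forall>v\<in>F. a v \<in> R" "v = (\<Sum>v\<in>F. sc (a v) v)"
      unfolding span_over_def by blast
    have "sc c v = (\<Sum>v\<in>F. sc (c * a v) v)"
      by (simp add: F(4) scale_sum_right)
    also have "\<dots> \<in> span_over R sc S"
      using F \<open>c \<in> R\<close> assms(4) by (intro spanI) auto
    finally show "sc c v \<in> span_over R sc S" .
  qed
qed

lemma closed_over_span_rat_adjoin:
  "module sc \<Longrightarrow> closed_over (rat_adjoin \<mu>) sc (span_over (rat_adjoin \<mu>) sc S)"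
  by (rule closed_over_span) (auto intro: rat_adjoin_add rat_adjoin_mult)

lemma linear_over_unique_span:
  assumes "module sc1" "module sc2" "1 \<in> R" "closed_over R sc1 (span_over R sc1 S)" "0 \<in> R"
    "linear_over R sc1 sc2 (span_over R sc1 S) f" "linear_over R sc1 sc2 (span_over R sc1 S) g"
    "\<And>v. v \<in> S \<Longrightarrow> f v = g v" "v \<in> span_over R sc1 S"
  shows "f v = g v"
proof -
  interpret m1: module sc1 by fact
  interpret m2: module sc2 by fact
  let ?V = "{v \<in> span_over R sc1 S. f v = g v}"
  \<comment> \<open>\<open>linear_over\<close> is silent about 0; the value there comes from scaling
    by the scalar 0, which lies in \<open>R\<close>.\<close>
  have f0: "f 0 = 0" "g 0 = 0"
    using assms(4-7) unfolding closed_over_def linear_over_def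
    by (metis m1.scale_zero_left m2.scale_zero_left)+
  have "closed_over R sc1 ?V"
    using assms(4,6,7) f0 unfolding closed_over_def linear_over_def by simp
  moreover have "S \<subseteq> ?V"
    using span_over_superset[OF assms(1,3)] assms(8) by blast
  ultimately show ?thesis using span_over_least assms(9) by blast
qed

subsection \<open>Linear combinations of words and the shuffle product\<close>

lemma lookup_scale_comb [simp]:
  "Poly_Mapping.lookup (scale_comb c p) w = c * Poly_Mapping.lookup p w"
  unfolding scale_comb_def by (transfer) (simp add: when_def)

lemma module_scale_comb: "module scale_comb"
  by unfold_locales (auto intro!: poly_mapping_eqI simp: lookup_add algebra_simps)

interpretation comb: module scale_comb by (rule module_scale_comb)

lemma module_times: "module ((*) :: complex \<Rightarrow> complex \<Rightarrow> complex)"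
  by unfold_locales (auto simp: algebra_simps)

lemma module_fps_const: "module (\<lambda>c (f :: complex fps). fps_const c * f)"
  by unfold_locales (auto simp: algebra_simps simp flip: fps_const_add fps_const_mult)

text \<open>The target is an arbitrary module, so that one set of lemmas serves both the shuffle
  product, with values in word combinations, and \<open>comb_series\<close>, with values in power
  series.\<close>

definition lext ::
    "(complex \<Rightarrow> 'b \<Rightarrow> 'b) \<Rightarrow> (letter list \<Rightarrow> 'b) \<Rightarrow> word_comb \<Rightarrow> 'b::ab_group_add" where
  "lext sc f p = (\<Sum>w\<in>Poly_Mapping.keys p. sc (Poly_Mapping.lookup p w) (f w))"

lemma lin_extend_eq_lext: "lin_extend f p = lext scale_comb f p"
  by (simp add: lin_extend_def lext_def)

context
  fixes sc :: "complex \<Rightarrow> 'b \<Rightarrow> 'b::ab_group_add"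
  assumes md: "module sc"
begin

interpretation module sc by (rule md)

lemma lext_superset:
  assumes "finite S" "Poly_Mapping.keys p \<subseteq> S"
  shows "lext sc f p = (\<Sum>w\<in>S. sc (Poly_Mapping.lookup p w) (f w))"
  unfolding lext_def using assms
  by (intro sum.mono_neutral_left) (auto simp: in_keys_iff)

lemma lext_add: "lext sc f (p + q) = lext sc f p + lext sc f q"
proof -
  let ?S = "Poly_Mapping.keys p \<union> Poly_Mapping.keys q"
  have "lext sc f r = (\<Sum>w\<in>?S. sc (Poly_Mapping.lookup r w) (f w))" if "r \<in> {p, q, p + q}" for r
    using that Poly_Mapping.keys_add[of p q] by (intro lext_superset) auto
  then show ?thesis
    by (simp add: lookup_add scale_left_distrib sum.distrib)
qed

lemma lext_scale: "lext sc f (scale_comb c p) = sc c (lext sc f p)"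
proof -
  have "Poly_Mapping.keys (scale_comb c p) \<subseteq> Poly_Mapping.keys p"
    by (auto simp: in_keys_iff)
  then have "lext sc f (scale_comb c p) =
      (\<Sum>w\<in>Poly_Mapping.keys p. sc (Poly_Mapping.lookup (scale_comb c p) w) (f w))"
    by (intro lext_superset) auto
  then show ?thesis
    by (simp add: lext_def scale_sum_right)
qed

lemma lext_word [simp]: "lext sc f (word w) = f w"
  by (simp add: lext_def word_def)

lemma lext_cong: "(\<And>w. w \<in> Poly_Mapping.keys p \<Longrightarrow> f w = g w) \<Longrightarrow> lext sc f p = lext sc g p"
  by (simp add: lext_def)

lemma lext_zero [simp]: "lext sc f 0 = 0"
  by (simp add: lext_def)

lemma lext_uminus: "lext sc f (- p) = - lext sc f p"
  using lext_add[of f p "- p"] by (simp add: eq_neg_iff_add_eq_0 add.commute)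

lemma lext_diff: "lext sc f (p - q) = lext sc f p - lext sc f q"
  using lext_add[of f p "- q"] by (simp add: lext_uminus)

lemma lext_sum: "lext sc f (sum g A) = (\<Sum>x\<in>A. lext sc f (g x))"
  by (induction A rule: infinite_finite_induct) (simp_all add: lext_add)

lemma lext_fun_diff: "lext sc (\<lambda>w. f w - g w) p = lext sc f p - lext sc g p"
  by (simp add: lext_def scale_right_diff_distrib sum_subtractf)

lemma lext_lin_extend: "lext sc f (lin_extend g p) = lext sc (\<lambda>w. lext sc f (g w)) p"
  unfolding lin_extend_def by (simp add: lext_sum lext_scale lext_def[of sc "\<lambda>w. lext sc f (g w)"])

end

lemma comb_eq_sum_words: "p = (\<Sum>w\<in>Poly_Mapping.keys p. scale_comb (Poly_Mapping.lookup p w) (word w))"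
proof (rule poly_mapping_eqI)
  fix v
  have *: "Poly_Mapping.lookup (scale_comb c (word w)) v = (if w = v then c else 0)" for c w
    by (simp add: word_def lookup_single when_def)
  show "Poly_Mapping.lookup p v =
      Poly_Mapping.lookup (\<Sum>w\<in>Poly_Mapping.keys p. scale_comb (Poly_Mapping.lookup p w) (word w)) v"
    unfolding lookup_sum * by (simp add: in_keys_iff)
qed

lemma keys_word [simp]: "Poly_Mapping.keys (word w) = {w}"
  by (simp add: word_def)

lemma keys_lin_extend:
  "Poly_Mapping.keys (lin_extend f p) \<subseteq> (\<Union>w\<in>Poly_Mapping.keys p. Poly_Mapping.keys (f w))"
proof
  fix v assume "v \<in> Poly_Mapping.keys (lin_extend f p)"
  then have "(\<Sum>w\<in>Poly_Mapping.keys p. Poly_Mapping.lookup p w * Poly_Mapping.lookup (f w) v) \<noteq> 0"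
    by (simp add: in_keys_iff lin_extend_def lookup_sum)
  then obtain w where "w \<in> Poly_Mapping.keys p"
      "Poly_Mapping.lookup p w * Poly_Mapping.lookup (f w) v \<noteq> 0"
    by (meson sum.neutral)
  then show "v \<in> (\<Union>w\<in>Poly_Mapping.keys p. Poly_Mapping.keys (f w))"
    by (auto simp: in_keys_iff)
qed

lemma lin_extend_word [simp]: "lin_extend f (word w) = f w"
  by (simp add: lin_extend_eq_lext lext_word[OF module_scale_comb])

lemma append_letter_word [simp]: "append_letter (word w) u = word (w @ [u])"
  by (simp add: append_letter_def)

lemma append_letter_add: "append_letter (p + q) u = append_letter p u + append_letter q u"
  by (simp add: append_letter_def lin_extend_eq_lext lext_add[OF module_scale_comb])

lemma append_letter_scale: "append_letter (scale_comb c p) u = scale_comb c (append_letter p u)"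
  by (simp add: append_letter_def lin_extend_eq_lext lext_scale[OF module_scale_comb])

lemma shuffle_word_word: "shuffle (word v) (word w) = shuffle_words v w"
  by (simp add: shuffle_def)

lemma shuffle_Nil [simp]: "shuffle_words [] w = word w" "shuffle_words v [] = word v"
  by (subst shuffle_words.simps; simp)+

lemma shuffle_snoc:
  "shuffle_words (v @ [a]) (w @ [b]) =
     append_letter (shuffle_words v (w @ [b])) a + append_letter (shuffle_words (v @ [a]) w) b"
  by (subst shuffle_words.simps) simp

lemma shuffle_words_induct [case_names Nil1 Nil2 snoc]:
  assumes "\<And>w. P [] w" "\<And>v. P v []"
    "\<And>v a w b. P v (w @ [b]) \<Longrightarrow> P (v @ [a]) w \<Longrightarrow> P (v @ [a]) (w @ [b])"
  shows "P v w"
proof (induction "length v + length w" arbitrary: v w rule: less_induct)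
  case less
  show ?case
  proof (cases v rule: rev_cases)
    case v: (snoc v' a)
    show ?thesis
    proof (cases w rule: rev_cases)
      case (snoc w' b)
      then show ?thesis using v less by (auto intro!: assms(3))
    qed (simp add: assms)
  qed (simp add: assms)
qed

subsection \<open>Words with positive partial sums\<close>

fun letter_weight :: "letter \<Rightarrow> rat" where
  "letter_weight Lx = 0"
| "letter_weight (Ly l) = l"

definition weight :: "letter list \<Rightarrow> rat" where
  "weight w = sum_list (map letter_weight w)"

lemma weight_simps [simp]:
  "weight [] = 0" "weight (u # w) = letter_weight u + weight w"
  "weight (v @ w) = weight v + weight w" "weight (replicate n Lx) = 0"
  by (simp_all add: weight_def sum_list_replicate)

text \<open>All nonempty prefixes are tested, not only those at block ends. As \<open>Lx\<close> has
  weight 0, this agrees with \<open>words1\<close> and rules out a leading \<open>Lx\<close>; the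
  letterwise form suits recursion on the last letter.\<close>

definition positive_word :: "letter list \<Rightarrow> bool" where
  "positive_word w \<longleftrightarrow> (\<forall>i\<in>{1..length w}. weight (take i w) > 0)"

lemma positive_word_Nil [simp]: "positive_word []"
  by (simp add: positive_word_def)

lemma positive_word_snoc [simp]:
  "positive_word (w @ [u]) \<longleftrightarrow> positive_word w \<and> weight (w @ [u]) > 0"
proof -
  have "{1..length (w @ [u])} = insert (Suc (length w)) {1..length w}" by auto
  then show ?thesis by (auto simp: positive_word_def)
qed

lemma positive_word_weight_nonneg: "positive_word w \<Longrightarrow> weight w \<ge> 0"
  by (cases w rule: rev_cases) auto

lemma positive_word_append_Lx:
  "positive_word (w @ replicate n Lx) \<longleftrightarrow> positive_word w \<and> (n = 0 \<or> weight w > 0)"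
proof (induction n)
  case (Suc n)
  have "w @ replicate (Suc n) Lx = (w @ replicate n Lx) @ [Lx]"
    by (simp add: replicate_append_same)
  then show ?case using Suc by (auto simp del: replicate_Suc append_assoc)
qed simp

lemma positive_word_append_Ly:
  assumes "positive_word w" "m > 0"
  shows "positive_word (w @ replicate n (Ly m))"
proof (induction n)
  case (Suc n)
  have "w @ replicate (Suc n) (Ly m) = (w @ replicate n (Ly m)) @ [Ly m]"
    by (simp add: replicate_append_same)
  then show ?case
    using Suc positive_word_weight_nonneg[OF Suc] assms(2)
    by (simp del: replicate_Suc append_assoc)
qed (simp add: assms)

lemma words1_eq: "words1 = {w. positive_word w}"
proof safe
  \<comment> \<open>The weight identity is carried along because positivity of the next prefix is a
    statement about it.\<close>
  have "positive_word (concat (map (\<lambda>(l, t). Ly l # replicate t Lx) lts)) \<and>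
      weight (concat (map (\<lambda>(l, t). Ly l # replicate t Lx) lts)) = sum_list (map fst lts)"
    if "\<forall>i\<in>{1..length lts}. sum_list (map fst (take i lts)) > 0" for lts :: "(rat \<times> nat) list"
    using that
  proof (induction lts rule: rev_induct)
    case (snoc lt lts)
    obtain l t where lt: "lt = (l, t)" by fastforce
    have "\<forall>i\<in>{1..length lts}. sum_list (map fst (take i lts)) > 0"
    proof
      fix i assume "i \<in> {1..length lts}"
      then show "sum_list (map fst (take i lts)) > 0" using bspec[OF snoc.prems, of i] by simp
    qed
    note IH = snoc.IH[OF this]
    have "sum_list (map fst lts) + l > 0"
      using bspec[OF snoc.prems, of "Suc (length lts)"] lt by simp
    then show ?case
      using IH lt positive_word_append_Lx[of "concat (map (\<lambda>(l, t). Ly l # replicate t Lx) lts) @ [Ly l]" t]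
      by simp
  qed simp
  then show "positive_word w" if "w \<in> words1" for w
    using that unfolding words1_def by blast
next
  fix w assume "positive_word w"
  then have "\<exists>lts. w = concat (map (\<lambda>(l, t). Ly l # replicate t Lx) lts) \<and>
      (\<forall>i\<in>{1..length lts}. sum_list (map fst (take i lts)) > 0) \<and> sum_list (map fst lts) = weight w"
  proof (induction w rule: rev_induct)
    case (snoc u w)
    then obtain lts where lts: "w = concat (map (\<lambda>(l, t). Ly l # replicate t Lx) lts)"
      "\<forall>i\<in>{1..length lts}. sum_list (map fst (take i lts)) > 0" "sum_list (map fst lts) = weight w"
      by auto
    show ?case
    proof (cases u)
      case Lx
      \<comment> \<open>A word cannot start with \<open>Lx\<close>, since that prefix has weight 0;
        so there is a last block to absorb the letter.\<close>
      then have "lts \<noteq> []" using snoc.prems lts by auto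
      then obtain lts' l t where l: "lts = lts' @ [(l, t)]"
        by (metis rev_exhaust surj_pair)
      have "\<forall>i\<in>{1..length (lts' @ [(l, Suc t)])}. sum_list (map fst (take i (lts' @ [(l, Suc t)]))) > 0"
      proof
        fix i assume "i \<in> {1..length (lts' @ [(l, Suc t)])}"
        moreover have "map fst (take i (lts' @ [(l, Suc t)])) = map fst (take i lts)"
          by (simp add: l flip: take_map)
        ultimately show "sum_list (map fst (take i (lts' @ [(l, Suc t)]))) > 0"
          using lts(2) l by auto
      qed
      then show ?thesis
        using lts l Lx by (intro exI[of _ "lts' @ [(l, Suc t)]"])
          (auto simp: replicate_append_same)
    next
      case (Ly l)
      have "\<forall>i\<in>{1..length (lts @ [(l, 0)])}. sum_list (map fst (take i (lts @ [(l, 0)]))) > 0"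
      proof
        fix i assume i: "i \<in> {1..length (lts @ [(l, 0 :: nat)])}"
        show "sum_list (map fst (take i (lts @ [(l, 0)]))) > 0"
        proof (cases "i = Suc (length lts)")
          case True
          then show ?thesis using snoc.prems lts(3) Ly by simp
        next
          case False
          then show ?thesis using i lts(2) by auto
        qed
      qed
      then show ?thesis
        using lts Ly by (intro exI[of _ "lts @ [(l, 0)]"]) auto
    qed
  qed (auto intro: exI[of _ "[]"])
  then show "w \<in> words1" unfolding words1_def by blast
qed

section \<open>Dictionary between positive bi-indices and positive words\<close>

lemma yx_word_from_snoc:
  assumes "length ks = length ms"
  shows "yx_word_from a (ks @ [k]) (ms @ [l]) =
    yx_word_from a ks ms @ Ly (l - last (a # ms)) # replicate (k - 1) Lx"
  using assms by (induction a ks ms rule: yx_word_from.induct) auto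

lemma positive_biindex_snoc:
  "positive_biindex (ks @ [k]) (ms @ [l]) \<longleftrightarrow> positive_biindex ks ms \<and> k \<ge> 1 \<and> l > 0"
  by (auto simp: positive_biindex_def)

lemma positive_biindex_induct [consumes 1, case_names Nil snoc]:
  assumes "positive_biindex ks ms" "P [] []"
    "\<And>ks ms k l. positive_biindex ks ms \<Longrightarrow> k \<ge> 1 \<Longrightarrow> l > 0 \<Longrightarrow> P ks ms \<Longrightarrow> P (ks @ [k]) (ms @ [l])"
  shows "P ks ms"
proof -
  have "length ks = length ms" using assms(1) by (simp add: positive_biindex_def)
  then show ?thesis using assms(1)
  proof (induction ks ms rule: rev_induct2)
    case (4 k ks l ms)
    then show ?case using assms(3) by (simp add: positive_biindex_snoc)
  qed (use assms(2) in simp_all)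
qed

text \<open>The differences of consecutive entries telescope, so the prefix weights are the entries
  of \<open>ms\<close> themselves.\<close>

lemma yx_word_from_positive:
  assumes "positive_biindex ks ms"
  shows "positive_word (yx_word_from 0 ks ms) \<and> weight (yx_word_from 0 ks ms) = last (0 # ms)"
  using assms
proof (induction rule: positive_biindex_induct)
  case (snoc ks ms k l)
  have "length ks = length ms" using snoc(1) by (simp add: positive_biindex_def)
  then show ?case
    using snoc positive_word_append_Lx[of "yx_word_from 0 ks ms @ [Ly (l - last (0 # ms))]" "k - 1"]
    by (simp add: yx_word_from_snoc)
qed simp

text \<open>Read from the left, a letter \<open>Ly l\<close> opens a new index 1 whose entry is the
  current weight plus \<open>l\<close>, and a letter \<open>Lx\<close> raises the last index by one.
  The entries are prefix weights, hence positive.\<close>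

lemma positive_word_cases_biindex:
  assumes "positive_word w"
  obtains ks ms where "positive_biindex ks ms" "w = yx_word_from 0 ks ms"
proof -
  have "\<exists>ks ms. positive_biindex ks ms \<and> w = yx_word_from 0 ks ms"
    using assms
  proof (induction w rule: rev_induct)
    case Nil
    show ?case by (intro exI[of _ "[]"]) (simp add: positive_biindex_def)
  next
    case (snoc u w)
    then obtain ks ms where k: "positive_biindex ks ms" "w = yx_word_from 0 ks ms" by auto
    then have len: "length ks = length ms" by (simp add: positive_biindex_def)
    have wt: "weight w = last (0 # ms)" using yx_word_from_positive k by blast
    show ?case
    proof (cases u)
      case (Ly l)
      have "last (0 # ms) + l > 0" using snoc.prems Ly wt by simp
      moreover have "w @ [u] = yx_word_from 0 (ks @ [1]) (ms @ [last (0 # ms) + l])"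
        using len k Ly by (simp add: yx_word_from_snoc del: last.simps)
      ultimately show ?thesis using k(1) positive_biindex_snoc
        by (intro exI[of _ "ks @ [1]"] exI[of _ "ms @ [last (0 # ms) + l]"]) (simp del: last.simps)
    next
      case Lx
      have "ms \<noteq> []" using snoc.prems Lx wt by auto
      then obtain ms' l where ms: "ms = ms' @ [l]" by (metis rev_exhaust)
      then obtain ks' i where ks: "ks = ks' @ [i]" using len by (cases ks rule: rev_cases) auto
      have i: "i \<ge> 1" "positive_biindex (ks' @ [Suc i]) ms"
        using k(1) by (simp_all add: ks ms positive_biindex_snoc)
      then have "w @ [u] = yx_word_from 0 (ks' @ [Suc i]) ms"
        using len k(2) Lx by (cases i) (simp_all add: ms ks yx_word_from_snoc replicate_append_same)
      then show ?thesis using i by blast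
    qed
  qed
  then show ?thesis using that by blast
qed

lemma positive_word_snoc_Lx_admissible:
  assumes "positive_word (w @ [Lx])"
  obtains ks ms where "admissible ks ms" "w @ [Lx] = yx_word_from 0 ks ms"
proof -
  from assms obtain ks ms where k: "positive_biindex ks ms" "w @ [Lx] = yx_word_from 0 ks ms"
    by (rule positive_word_cases_biindex)
  from k(1) have "ks \<noteq> [] \<and> last ks > 1"
  proof (cases ks rule: rev_cases)
    case Nil
    then show ?thesis using k(2) by simp
  next
    case (snoc ks' i)
    then obtain ms' l where ms: "ms = ms' @ [l]"
      using k(1) by (cases ms rule: rev_cases) (auto simp: positive_biindex_def)
    have "i \<noteq> 1"
    proof
      assume "i = 1"
      then have "last (w @ [Lx]) = Ly (l - last (0 # ms'))"
        unfolding k(2) using k(1) by (simp add: snoc ms yx_word_from_snoc positive_biindex_def)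
      then show False by simp
    qed
    then show ?thesis using k(1) snoc ms by (simp add: positive_biindex_snoc)
  qed
  with k that show ?thesis unfolding admissible_def by blast
qed

lemma positive_word_snoc_Ly_special:
  assumes "positive_word (w @ [Ly a])" "positive_word (w @ [Ly b])" "a \<noteq> b"
  obtains ks ms ms' where "special_triple ks ms ms'"
    "w @ [Ly a] = yx_word_from 0 ks ms" "w @ [Ly b] = yx_word_from 0 ks ms'"
proof -
  from assms have "positive_word w" by simp
  then obtain ks ms where k: "positive_biindex ks ms" "w = yx_word_from 0 ks ms"
    by (rule positive_word_cases_biindex)
  then have len: "length ks = length ms" by (simp add: positive_biindex_def)
  have wt: "weight w = last (0 # ms)" using yx_word_from_positive k by blast
  show ?thesis
  proof (rule that[of "ks @ [1]" "ms @ [last (0 # ms) + a]" "ms @ [last (0 # ms) + b]"])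
    show "special_triple (ks @ [1]) (ms @ [last (0 # ms) + a]) (ms @ [last (0 # ms) + b])"
      using assms wt k(1) unfolding special_triple_def
      by (simp add: positive_biindex_snoc del: last.simps)
  qed (use len k in \<open>simp_all add: yx_word_from_snoc del: last.simps\<close>)
qed

section \<open>Coefficientwise description of \<open>H1\<close> and its stability under
  shuffles\<close>

lemma keys_append_letter: "Poly_Mapping.keys (append_letter p u) \<subseteq> (\<lambda>w. w @ [u]) ` Poly_Mapping.keys p"
  unfolding append_letter_def using keys_lin_extend[of "\<lambda>w. word (w @ [u])" p] by auto

text \<open>A prefix of a shuffle is a shuffle of prefixes and weights add up, so no prefix weight
  can become nonpositive. That all resulting words share one weight is what later allows a common
  power of \<open>t\<close> to be removed.\<close>

lemma keys_shuffle_words: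
  assumes "positive_word v" "positive_word w" "z \<in> Poly_Mapping.keys (shuffle_words v w)"
  shows "positive_word z \<and> weight z = weight v + weight w"
  using assms
proof (induction v w arbitrary: z rule: shuffle_words_induct)
  case (snoc v a w b)
  from snoc.prems(3) have "z \<in> Poly_Mapping.keys (append_letter (shuffle_words v (w @ [b])) a) \<or>
      z \<in> Poly_Mapping.keys (append_letter (shuffle_words (v @ [a]) w) b)"
    using Poly_Mapping.keys_add unfolding shuffle_snoc by (meson UnE subsetD)
  then obtain z' where "z' \<in> Poly_Mapping.keys (shuffle_words v (w @ [b])) \<and> z = z' @ [a] \<or>
      z' \<in> Poly_Mapping.keys (shuffle_words (v @ [a]) w) \<and> z = z' @ [b]"
    using keys_append_letter[of "shuffle_words v (w @ [b])" a]
      keys_append_letter[of "shuffle_words (v @ [a]) w" b] by auto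
  then show ?case
    using snoc.IH(1)[of z'] snoc.IH(2)[of z'] snoc.prems(1,2) by auto
qed auto

text \<open>Words form a basis, so membership in a span of words can be read off the
  coefficients.\<close>

lemma H1_eq: "H1 \<mu> = {p. \<forall>w. Poly_Mapping.lookup p w \<in> rat_adjoin \<mu> \<and>
    (w \<in> Poly_Mapping.keys p \<longrightarrow> positive_word w)}" (is "_ = ?V")
proof
  have "closed_over (rat_adjoin \<mu>) scale_comb ?V"
    unfolding closed_over_def
    by (auto simp: lookup_add rat_adjoin_add rat_adjoin_mult in_keys_iff) (metis add_0)
  moreover have "word ` words1 \<subseteq> ?V"
    by (auto simp: words1_eq) (simp add: word_def lookup_single when_def)
  ultimately show "H1 \<mu> \<subseteq> ?V"
    unfolding H1_def by (rule span_over_least)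
next
  have cl: "closed_over (rat_adjoin \<mu>) scale_comb (H1 \<mu>)"
    unfolding H1_def by (rule closed_over_span_rat_adjoin[OF module_scale_comb])
  have wd: "word w \<in> H1 \<mu>" if "positive_word w" for w
    using that span_over_superset[OF module_scale_comb, of "rat_adjoin \<mu>" "word ` words1"]
    by (auto simp: words1_eq H1_def)
  show "?V \<subseteq> H1 \<mu>"
  proof
    fix p assume "p \<in> ?V"
    then show "p \<in> H1 \<mu>"
      by (subst comb_eq_sum_words) (auto intro!: closed_over_sum[OF cl] closed_overD(3)[OF cl] wd)
  qed
qed

lemma closed_over_H1: "closed_over (rat_adjoin \<mu>) scale_comb (H1 \<mu>)"
  unfolding H1_def by (rule closed_over_span_rat_adjoin[OF module_scale_comb])

lemma closed_over_H0: "closed_over (rat_adjoin \<mu>) scale_comb (H0 \<mu>)"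
  unfolding H0_def by (rule closed_over_span_rat_adjoin[OF module_scale_comb])

lemma word_in_H1: "positive_word w \<Longrightarrow> word w \<in> H1 \<mu>"
  by (auto simp: H1_eq) (simp add: word_def lookup_single when_def)

lemma lin_extend_closed:
  assumes "closed_over (rat_adjoin \<mu>) scale_comb V"
    "\<And>w. Poly_Mapping.lookup p w \<in> rat_adjoin \<mu>"
    "\<And>w. w \<in> Poly_Mapping.keys p \<Longrightarrow> f w \<in> V"
  shows "lin_extend f p \<in> V"
  unfolding lin_extend_def using assms
  by (auto intro!: closed_over_sum[OF assms(1)] closed_overD(3)[OF assms(1)])

lemma lookup_shuffle_words: "Poly_Mapping.lookup (shuffle_words v w) z \<in> rat_adjoin \<mu>"
proof -
  let ?V = "{p :: word_comb. \<forall>z. Poly_Mapping.lookup p z \<in> rat_adjoin \<mu>}"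
  have cl: "closed_over (rat_adjoin \<mu>) scale_comb ?V"
    by (auto simp: closed_over_def lookup_add rat_adjoin_add rat_adjoin_mult)
  have wd: "word w \<in> ?V" for w by (simp add: word_def lookup_single when_def)
  have "shuffle_words v w \<in> ?V"
  proof (induction v w rule: shuffle_words_induct)
    case (snoc v a w b)
    then show ?case unfolding shuffle_snoc append_letter_def
      by (intro closed_overD(2)[OF cl] lin_extend_closed[OF cl] wd) auto
  qed (use wd in simp_all)
  then show ?thesis by simp
qed

lemma shuffle_words_in_H1:
  "positive_word v \<Longrightarrow> positive_word w \<Longrightarrow> shuffle_words v w \<in> H1 \<mu>"
  by (auto simp: H1_eq lookup_shuffle_words dest: keys_shuffle_words)

lemma shuffle_in_H1: "p \<in> H1 \<mu> \<Longrightarrow> q \<in> H1 \<mu> \<Longrightarrow> shuffle p q \<in> H1 \<mu>"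
  unfolding shuffle_def
  by (intro lin_extend_closed[OF closed_over_H1] shuffle_words_in_H1) (simp_all add: H1_eq)

lemma H0_subset_H1: "H0 \<mu> \<subseteq> H1 \<mu>"
  unfolding H0_def
proof (rule span_over_least[OF closed_over_H1], safe)
  show "word [] \<in> H1 \<mu>" by (simp add: word_in_H1)
  show "yx_word ks ms \<in> H1 \<mu>" if "admissible ks ms" for ks ms
    using that yx_word_from_positive word_in_H1 unfolding yx_word_def admissible_def by blast
  show "yx_word ks ms - yx_word ks ms' \<in> H1 \<mu>" if "special_triple ks ms ms'" for ks ms ms'
    using that unfolding yx_word_def special_triple_def
    by (auto intro!: closed_over_diff[OF module_scale_comb _ closed_over_H1] word_in_H1
        dest: yx_word_from_positive)
qed

subsection \<open>Generation of \<open>H1\<close> by \<open>H0\<close> and one letter\<close>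

text \<open>The polynomials in \<open>y_m\<close> with coefficients in \<open>H0\<close>, for the
  shuffle product. The induction rule is used both to attach a polynomial over \<open>Z_mu\<close>
  to each element and to show that two candidate maps agree.\<close>

inductive_set generated :: "complex \<Rightarrow> rat \<Rightarrow> word_comb set" for \<mu> m where
  base: "p \<in> H0 \<mu> \<Longrightarrow> p \<in> generated \<mu> m"
| add: "p \<in> generated \<mu> m \<Longrightarrow> q \<in> generated \<mu> m \<Longrightarrow> p + q \<in> generated \<mu> m"
| scale: "c \<in> rat_adjoin \<mu> \<Longrightarrow> p \<in> generated \<mu> m \<Longrightarrow> scale_comb c p \<in> generated \<mu> m"
| shuffle: "p \<in> generated \<mu> m \<Longrightarrow> shuffle (word [Ly m]) p \<in> generated \<mu> m"

lemma closed_over_generated: "closed_over (rat_adjoin \<mu>) scale_comb (generated \<mu> m)"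
  unfolding closed_over_def
  using closed_overD(1)[OF closed_over_H0] by (auto intro: generated.intros)

lemmas generated_diff = closed_over_diff[OF module_scale_comb _ closed_over_generated]

text \<open>Shuffling a letter into a power of itself produces integer multiplicities; they are
  divided out here, the inverse being a rational scalar.\<close>

lemma generated_unscale:
  assumes "scale_comb (of_nat n) p \<in> generated \<mu> m" "n > 0"
  shows "p \<in> generated \<mu> m"
  using generated.scale[OF _ assms(1), of "inverse (of_nat n)"] assms(2) by simp

text \<open>The length of the run of y-letters after the last \<open>Lx\<close>. Positive words with
  value 0 lie in \<open>H0\<close>; the value is the induction measure for generation.\<close>

definition trailing :: "letter list \<Rightarrow> nat" where
  "trailing w = length (takeWhile (\<lambda>u. u \<noteq> Lx) (rev w))"

lemma trailing_simps [simp]: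
  "trailing [] = 0" "trailing (w @ [Lx]) = 0" "trailing (w @ [Ly l]) = Suc (trailing w)"
  by (simp_all add: trailing_def)

lemma trailing_append_replicate [simp]:
  "trailing (w @ replicate n (Ly l)) = trailing w + n"
proof (induction n)
  case (Suc n)
  have "w @ replicate (Suc n) (Ly l) = (w @ replicate n (Ly l)) @ [Ly l]"
    by (simp add: replicate_append_same)
  then show ?case using Suc by (simp only: trailing_simps)
qed simp

lemma trailing_split:
  obtains u t where "w = u @ t" "trailing w = length t" "u = [] \<or> (\<exists>u'. u = u' @ [Lx])"
    "\<forall>a\<in>set t. \<exists>l. a = Ly l"
proof -
  have "\<exists>u t. w = u @ t \<and> trailing w = length t \<and> (u = [] \<or> (\<exists>u'. u = u' @ [Lx])) \<and>
    (\<forall>a\<in>set t. \<exists>l. a = Ly l)"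
  proof (induction w rule: rev_induct)
    case (snoc a w)
    then obtain u t where IH: "w = u @ t" "trailing w = length t" "u = [] \<or> (\<exists>u'. u = u' @ [Lx])"
      "\<forall>a\<in>set t. \<exists>l. a = Ly l" by blast
    show ?case
    proof (cases a)
      case Lx
      then show ?thesis by (intro exI[of _ "w @ [a]"] exI[of _ "[]"]) simp
    next
      case (Ly l)
      then show ?thesis using IH(2-4) by (intro exI[of _ u] exI[of _ "t @ [a]"])
        (auto simp: IH(1) simp flip: append_assoc)
    qed
  qed simp
  then show ?thesis using that by blast
qed

text \<open>The inserted letter lengthens the final run by one if it lands in it, and leaves it
  alone otherwise.\<close>

lemma trailing_shuffle_letter:
  assumes "z \<in> Poly_Mapping.keys (shuffle_words [Ly m] w)"
  shows "trailing z \<le> Suc (trailing w)"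
  using assms
proof (induction w arbitrary: z rule: rev_induct)
  case Nil
  then show ?case using trailing_simps(3)[of "[]" m] by (simp del: trailing_simps(3))
next
  case (snoc b w)
  have "shuffle_words [Ly m] (w @ [b]) =
      word (w @ [b, Ly m]) + append_letter (shuffle_words [Ly m] w) b"
    using shuffle_snoc[of "[]" "Ly m" w b] by simp
  then have "z = w @ [b, Ly m] \<or> z \<in> Poly_Mapping.keys (append_letter (shuffle_words [Ly m] w) b)"
    using snoc.prems Poly_Mapping.keys_add[of "word (w @ [b, Ly m])"] by fastforce
  then consider "z = (w @ [b]) @ [Ly m]" |
      z' where "z' \<in> Poly_Mapping.keys (shuffle_words [Ly m] w)" "z = z' @ [b]"
    using keys_append_letter[of "shuffle_words [Ly m] w" b] by auto
  then show ?case
  proof cases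
    case 1
    then show ?thesis by (simp only: trailing_simps)
  next
    case 2
    then show ?thesis using snoc.IH by (cases b) auto
  qed
qed

section \<open>Shuffling one letter into a word\<close>

abbreviation append_word :: "word_comb \<Rightarrow> letter list \<Rightarrow> word_comb" where
  "append_word p t \<equiv> lin_extend (\<lambda>w. word (w @ t)) p"

lemma append_letter_append_word: "append_letter (append_word p t) u = append_word p (t @ [u])"
  unfolding append_letter_def lin_extend_eq_lext
  using lext_lin_extend[OF module_scale_comb, of "\<lambda>w. word (w @ [u])" "\<lambda>w. word (w @ t)" p]
  by (simp add: lin_extend_eq_lext lext_word[OF module_scale_comb])

lemma scale_comb_Suc: "scale_comb (of_nat (Suc n)) p = p + scale_comb (of_nat n) p"
  by (simp add: comb.scale_left_distrib)

text \<open>Behind \<open>z\<close> there are \<open>j + 1\<close> slots for the new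
  \<open>y\<close>, all giving the same word; the slots before \<open>z\<close> shuffle
  \<open>y\<close> into \<open>v\<close> and leave the tail untouched.\<close>

lemma shuffle_letter_snoc_replicate:
  "shuffle_words [y] (v @ [z] @ replicate j y) =
     scale_comb (of_nat (Suc j)) (word (v @ [z] @ replicate (Suc j) y)) +
     append_word (shuffle_words [y] v) (z # replicate j y)"
proof (induction j)
  case 0
  show ?case using shuffle_snoc[of "[]" y v z] by (simp add: append_letter_def)
next
  case (Suc j)
  have "shuffle_words [y] (v @ [z] @ replicate (Suc j) y) =
      word (v @ [z] @ replicate (Suc (Suc j)) y) +
      append_letter (shuffle_words [y] (v @ [z] @ replicate j y)) y"
    using shuffle_snoc[of "[]" y "v @ [z] @ replicate j y" y]
    by (simp add: replicate_append_same)
  also have "append_letter (shuffle_words [y] (v @ [z] @ replicate j y)) y =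
      scale_comb (of_nat (Suc j)) (word (v @ [z] @ replicate (Suc (Suc j)) y)) +
      append_word (shuffle_words [y] v) (z # replicate (Suc j) y)"
    unfolding Suc append_letter_add append_letter_scale append_letter_append_word
    by (simp add: replicate_append_same)
  finally show ?case
    by (simp only: scale_comb_Suc[of "Suc j"] add.assoc)
qed

lemma shuffle_letter_replicate:
  "shuffle_words [y] (replicate j y) = scale_comb (of_nat (Suc j)) (word (replicate (Suc j) y))"
proof (induction j)
  case (Suc j)
  have "shuffle_words [y] (replicate (Suc j) y) =
      word (replicate (Suc (Suc j)) y) + append_letter (shuffle_words [y] (replicate j y)) y"
    using shuffle_snoc[of "[]" y "replicate j y" y] by (simp add: replicate_append_same)
  then show ?case
    unfolding Suc append_letter_scale
    by (simp only: scale_comb_Suc[of "Suc j"] append_letter_word append_Cons replicate_append_same replicate_Suc)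
qed simp

lemma word_Lx_in_H0:
  assumes "positive_word (w @ [Lx])"
  shows "word (w @ [Lx]) \<in> H0 \<mu>"
proof -
  obtain ks ms where "admissible ks ms" "w @ [Lx] = yx_word_from 0 ks ms"
    using positive_word_snoc_Lx_admissible[OF assms] .
  then show ?thesis unfolding H0_def
    by (intro subsetD[OF span_over_superset[OF module_scale_comb]]) (auto simp: yx_word_def)
qed

lemma word_Ly_diff_in_H0:
  assumes "positive_word (w @ [Ly a])" "positive_word (w @ [Ly b])"
  shows "word (w @ [Ly a]) - word (w @ [Ly b]) \<in> H0 \<mu>"
proof (cases "a = b")
  case True
  then show ?thesis using closed_overD(1)[OF closed_over_H0] by simp
next
  case False
  obtain ks ms ms' where "special_triple ks ms ms'"
    "w @ [Ly a] = yx_word_from 0 ks ms" "w @ [Ly b] = yx_word_from 0 ks ms'"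
    using positive_word_snoc_Ly_special[OF assms False] .
  then show ?thesis unfolding H0_def
    by (intro subsetD[OF span_over_superset[OF module_scale_comb]])
       (auto simp: yx_word_def)
qed

text \<open>With \<open>y = y\<^sub>m\<close> and \<open>z = y\<^sub>l\<close>, the coefficient of \<open>v z y\<^sup>p\<close> in \<open>y \<squnion> v z y\<^sup>p\<^sup>-\<^sup>1\<close> is \<open>p\<close>, and the
  remaining terms end in \<open>z y\<^sup>p\<^sup>-\<^sup>1\<close>. So if \<open>z\<close> may be replaced by \<open>y\<close> in front of \<open>y\<^sup>p\<^sup>-\<^sup>1\<close>
  (which for \<open>p = 1\<close> is a quasi-admissible relation), it may be replaced in front of \<open>y\<^sup>p\<close>.\<close>

lemma generated_replace_letter:
  assumes m: "m > 0"
    and IH: "\<And>w. positive_word w \<Longrightarrow> trailing w < n \<Longrightarrow> word w \<in> generated \<mu> m"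
    and v: "positive_word (v @ [Ly l])" "trailing v + Suc p \<le> n"
  shows "word (v @ Ly l # replicate p (Ly m)) - word (v @ Ly m # replicate p (Ly m)) \<in> generated \<mu> m"
  using v
proof (induction p arbitrary: v l)
  case 0
  have "positive_word (v @ [Ly m])"
    using positive_word_append_Ly[of v m 1] m 0(1) by simp
  with 0(1) show ?case
    using word_Ly_diff_in_H0 by (auto intro: generated.base)
next
  case (Suc p)
  let ?y = "Ly m"
  have pv: "positive_word v" using Suc.prems by simp
  define P where "P = append_word (shuffle_words [?y] v)"
  have A: "scale_comb (of_nat (Suc p)) (word (v @ [Ly k] @ replicate (Suc p) ?y)) +
      P (Ly k # replicate p ?y) \<in> generated \<mu> m" if "positive_word (v @ [Ly k])" for k
  proof -
    have "positive_word (v @ [Ly k] @ replicate p ?y)"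
      using positive_word_append_Ly[OF that m] by simp
    moreover have "trailing (v @ [Ly k] @ replicate p ?y) < n"
      using trailing_append_replicate[of "v @ [Ly k]" p m] Suc.prems(2) by simp
    ultimately have "shuffle (word [?y]) (word (v @ [Ly k] @ replicate p ?y)) \<in> generated \<mu> m"
      using IH generated.shuffle by blast
    then show ?thesis
      unfolding shuffle_word_word shuffle_letter_snoc_replicate P_def .
  qed
  have pm: "positive_word (v @ [?y])"
    using positive_word_append_Ly[OF pv m, of 1] by simp
  have "P (Ly l # replicate p ?y) - P (?y # replicate p ?y) =
      lin_extend (\<lambda>w. word (w @ Ly l # replicate p ?y) - word (w @ ?y # replicate p ?y))
        (shuffle_words [?y] v)"
    unfolding P_def lin_extend_eq_lext lext_fun_diff[OF module_scale_comb] ..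
  also have "\<dots> \<in> generated \<mu> m"
  proof (rule lin_extend_closed[OF closed_over_generated lookup_shuffle_words])
    fix w assume w: "w \<in> Poly_Mapping.keys (shuffle_words [?y] v)"
    have "positive_word [?y]" using positive_word_append_Ly[of "[]" m 1] m by simp
    then have "positive_word w" "weight w = m + weight v"
      using keys_shuffle_words[OF _ pv w] by auto
    \<comment> \<open>\<open>l\<close> may be negative, but the weight of \<open>w\<close> exceeds
      that of \<open>v\<close> by \<open>m > 0\<close>, so positivity survives.\<close>
    then have "positive_word (w @ [Ly l])" using Suc.prems(1) m by simp
    \<comment> \<open>The final run may grow by one when \<open>y\<close> is shuffled into
      \<open>v\<close>; \<open>p\<close> dropping by one pays for it.\<close>
    moreover have "trailing w + Suc p \<le> n"
      using trailing_shuffle_letter[OF w] Suc.prems(2) by simp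
    ultimately show "word (w @ Ly l # replicate p ?y) - word (w @ ?y # replicate p ?y) \<in> generated \<mu> m"
      by (rule Suc.IH)
  qed
  finally have B: "P (Ly l # replicate p ?y) - P (?y # replicate p ?y) \<in> generated \<mu> m" .
  let ?W = "\<lambda>k. word (v @ [Ly k] @ replicate (Suc p) ?y)"
  have "scale_comb (of_nat (Suc p)) (?W l - ?W m) =
      (scale_comb (of_nat (Suc p)) (?W l) + P (Ly l # replicate p ?y)) -
      (scale_comb (of_nat (Suc p)) (?W m) + P (?y # replicate p ?y)) -
      (P (Ly l # replicate p ?y) - P (?y # replicate p ?y))"
    by (simp add: comb.scale_right_diff_distrib)
  also have "\<dots> \<in> generated \<mu> m"
    by (intro generated_diff A B pm Suc.prems(1)) auto
  finally show ?case
    using generated_unscale by fastforce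
qed

text \<open>Write \<open>w = u t\<close> with \<open>t\<close> the run after the last
  \<open>Lx\<close>, of length \<open>n\<close>. Shuffling \<open>y_m\<close> into \<open>u\<close>
  followed by \<open>n - 1\<close> copies of \<open>y_m\<close> gives \<open>n\<close> times
  \<open>u\<close> followed by \<open>n\<close> copies, plus words with shorter runs. From there the
  letters of \<open>t\<close> are restored by \<open>generated_replace_letter\<close>.\<close>

lemma word_in_generated:
  assumes m: "m > 0" and w: "positive_word w"
  shows "word w \<in> generated \<mu> m"
  using w
proof (induction "trailing w" arbitrary: w rule: less_induct)
  case less
  let ?n = "trailing w" and ?y = "Ly m"
  have IH: "\<And>w'. positive_word w' \<Longrightarrow> trailing w' < ?n \<Longrightarrow> word w' \<in> generated \<mu> m"
    using less.hyps by blast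
  obtain u t where ut: "w = u @ t" "?n = length t" "u = [] \<or> (\<exists>u'. u = u' @ [Lx])"
    "\<forall>a\<in>set t. \<exists>l. a = Ly l"
    by (rule trailing_split)
  have tu: "trailing u = 0" using ut(3) by auto
  have pu: "positive_word u" using less.prems ut(1)
    by (induction t arbitrary: w rule: rev_induct) (auto simp flip: append_assoc)
  have base: "word (u @ replicate ?n ?y) \<in> generated \<mu> m"
  proof (cases ?n)
    case 0
    have "word u \<in> H0 \<mu>"
      using ut(3)
    proof
      assume "u = []"
      then show ?thesis unfolding H0_def
        by (intro subsetD[OF span_over_superset[OF module_scale_comb]]) auto
    qed (use pu word_Lx_in_H0 in blast)
    then show ?thesis using 0 by (simp add: generated.base)
  next
    case (Suc j)
    have sh: "shuffle_words [?y] (u @ replicate j ?y) \<in> generated \<mu> m"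
      unfolding shuffle_word_word[symmetric] using Suc tu
      by (intro generated.shuffle IH positive_word_append_Ly pu m) simp
    from ut(3) have "scale_comb (of_nat (Suc j)) (word (u @ replicate (Suc j) ?y)) \<in> generated \<mu> m"
    proof
      assume "u = []"
      then show ?thesis using sh by (simp add: shuffle_letter_replicate)
    next
      assume "\<exists>u'. u = u' @ [Lx]"
      then obtain u' where u: "u = u' @ [Lx]" by blast
      have "append_word (shuffle_words [?y] u') (Lx # replicate j ?y) \<in> generated \<mu> m"
      proof (rule lin_extend_closed[OF closed_over_generated lookup_shuffle_words])
        fix z assume z: "z \<in> Poly_Mapping.keys (shuffle_words [?y] u')"
        have "positive_word [?y]" using positive_word_append_Ly[of "[]" m 1] m by simp
        then have "positive_word z" "weight z = m + weight u'"
          using keys_shuffle_words[OF _ _ z] pu u by auto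
        then have "positive_word (z @ [Lx])" using pu u m by simp
        from positive_word_append_Ly[OF this m, of j]
        have "positive_word (z @ Lx # replicate j ?y)" by simp
        moreover have "trailing (z @ Lx # replicate j ?y) < ?n"
          using trailing_append_replicate[of "z @ [Lx]" j m] Suc by simp
        ultimately show "word (z @ Lx # replicate j ?y) \<in> generated \<mu> m" by (rule IH)
      qed
      with sh generated_diff show ?thesis
        using shuffle_letter_snoc_replicate[of ?y u' Lx j] unfolding u
        by fastforce
    qed
    then show ?thesis using Suc generated_unscale by fastforce
  qed
  \<comment> \<open>The letters of \<open>t\<close> turn into \<open>y_m\<close> from the right end,
    so that a power of \<open>y_m\<close> always follows the letter being exchanged, as
    \<open>generated_replace_letter\<close> demands.\<close>
  have "word (u @ t @ replicate j ?y) \<in> generated \<mu> m"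
    if "positive_word (u @ t)" "length t + j = ?n" "\<forall>a\<in>set t. \<exists>l. a = Ly l" for t j
    using that
  proof (induction t arbitrary: j rule: rev_induct)
    case Nil
    then show ?case using base by simp
  next
    case (snoc a t)
    obtain l where a: "a = Ly l" using snoc.prems by auto
    have "trailing (u @ t) = length t"
      using snoc.prems(3) tu by (induction t rule: rev_induct) (auto simp flip: append_assoc)
    then have "word ((u @ t) @ Ly l # replicate j ?y) - word ((u @ t) @ ?y # replicate j ?y) \<in> generated \<mu> m"
      using snoc.prems a by (intro generated_replace_letter[OF m IH]) auto
    moreover have "word (u @ t @ replicate (Suc j) ?y) \<in> generated \<mu> m"
      using snoc.prems by (intro snoc.IH) (auto simp flip: append_assoc)
    ultimately show ?case
      using generated.add by (fastforce simp: a)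
  qed
  from this[of t 0] show ?case using less.prems ut by simp
qed

lemma H1_eq_generated:
  assumes "m > 0"
  shows "H1 \<mu> = generated \<mu> m"
proof
  show "H1 \<mu> \<subseteq> generated \<mu> m"
    unfolding H1_def using word_in_generated[OF assms]
    by (intro span_over_least[OF closed_over_generated]) (auto simp: words1_eq)
  have "positive_word [Ly m]" using positive_word_append_Ly[of "[]" m 1] assms by simp
  then have y: "word [Ly m] \<in> H1 \<mu>" by (rule word_in_H1)
  have "p \<in> H1 \<mu>" if "p \<in> generated \<mu> m" for p
    using that
  proof induction
    case (base p)
    then show ?case using H0_subset_H1 by blast
  qed (auto intro: closed_overD[OF closed_over_H1] shuffle_in_H1 y)
  then show "generated \<mu> m \<subseteq> H1 \<mu>" by blast
qed

subsection \<open>Polylogarithm series of words\<close>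

text \<open>\<open>series \<mu> w\<close> is the polylogarithm attached to \<open>w\<close>, i.e. the iterated integral from \<open>0\<close> to \<open>t\<close>
  of the forms \<open>x = dt/t\<close> and \<open>y\<^sub>l = \<mu> t\<^bsup>l-1\<^esup> dt/(1 - t\<^bsup>\<mu>\<^esup>)\<close>, written as a power series in \<open>q = t\<^bsup>\<mu>\<^esup>\<close>
  after removing the factor \<open>t\<close> to the power \<open>weight w\<close>. The operator \<open>t d/dt\<close> then becomes
  \<open>weight w + \<mu> q d/dq\<close>, and \<open>fps_prim\<close> is its inverse.\<close>

definition fps_prim :: "complex \<Rightarrow> rat \<Rightarrow> complex fps \<Rightarrow> complex fps" where
  "fps_prim \<mu> s f = Abs_fps (\<lambda>n. fps_nth f n / (of_nat n * \<mu> + of_rat s))"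

text \<open>Relative to \<open>dt/t\<close>, and with \<open>t\<close> to the power \<open>l\<close>
  removed, the form of \<open>Ly l\<close> is \<open>\<mu> / (1 - q)\<close>, whence the constant
  coefficients; \<open>l\<close> acts only through the weight in \<open>fps_prim\<close>.\<close>

fun letter_fps :: "complex \<Rightarrow> letter \<Rightarrow> complex fps" where
  "letter_fps \<mu> Lx = 1"
| "letter_fps \<mu> (Ly l) = Abs_fps (\<lambda>_. \<mu>)"

fun rev_series :: "complex \<Rightarrow> letter list \<Rightarrow> complex fps" where
  "rev_series \<mu> [] = 1"
| "rev_series \<mu> (u # w) = fps_prim \<mu> (weight (u # w)) (letter_fps \<mu> u * rev_series \<mu> w)"

definition series :: "complex \<Rightarrow> letter list \<Rightarrow> complex fps" where
  "series \<mu> w = rev_series \<mu> (rev w)"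

lemma series_Nil [simp]: "series \<mu> [] = 1"
  by (simp add: series_def)

lemma weight_rev [simp]: "weight (rev w) = weight w"
  by (induction w) simp_all

lemma series_snoc: "series \<mu> (w @ [u]) = fps_prim \<mu> (weight (w @ [u])) (letter_fps \<mu> u * series \<mu> w)"
  by (simp add: series_def add.commute)

definition comb_series :: "complex \<Rightarrow> word_comb \<Rightarrow> complex fps" where
  "comb_series \<mu> = lext (\<lambda>c f. fps_const c * f) (series \<mu>)"

lemma comb_series_simps:
  "comb_series \<mu> (p + q) = comb_series \<mu> p + comb_series \<mu> q"
  "comb_series \<mu> (p - q) = comb_series \<mu> p - comb_series \<mu> q"
  "comb_series \<mu> (scale_comb c p) = fps_const c * comb_series \<mu> p"
  "comb_series \<mu> (word w) = series \<mu> w"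
  unfolding comb_series_def
  by (simp_all add: lext_add[OF module_fps_const] lext_diff[OF module_fps_const]
      lext_scale[OF module_fps_const] lext_word[OF module_fps_const])

lemma fps_prim_add: "fps_prim \<mu> s (f + g) = fps_prim \<mu> s f + fps_prim \<mu> s g"
  by (simp add: fps_prim_def fps_eq_iff add_divide_distrib)

lemma fps_prim_lext:
  "fps_prim \<mu> s (g * lext (\<lambda>c f. fps_const c * f) f p) =
    lext (\<lambda>c f. fps_const c * f) (\<lambda>w. fps_prim \<mu> s (g * f w)) p"
proof -
  have sc: "fps_prim \<mu> s (g * (fps_const c * h)) = fps_const c * fps_prim \<mu> s (g * h)" for c h
    by (simp add: fps_prim_def fps_eq_iff mult.left_commute[of g])
  have "fps_prim \<mu> s 0 = 0" by (simp add: fps_prim_def fps_eq_iff)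
  then have "fps_prim \<mu> s (\<Sum>w\<in>A. h w) = (\<Sum>w\<in>A. fps_prim \<mu> s (h w))" for h :: "letter list \<Rightarrow> _" and A
    by (induction A rule: infinite_finite_induct) (simp_all add: fps_prim_add)
  then show ?thesis
    unfolding lext_def by (simp add: sum_distrib_left sc)
qed

text \<open>\<open>fps_prim\<close> depends on the weight, so it passes to combinations only when
  all their words share one weight; for shuffles of two positive words this is
  \<open>keys_shuffle_words\<close>.\<close>

lemma comb_series_append_letter:
  assumes "\<And>w. w \<in> Poly_Mapping.keys p \<Longrightarrow> weight w = s"
  shows "comb_series \<mu> (append_letter p u) =
    fps_prim \<mu> (s + letter_weight u) (letter_fps \<mu> u * comb_series \<mu> p)"
proof -
  have "comb_series \<mu> (append_letter p u) =
      lext (\<lambda>c f. fps_const c * f) (\<lambda>w. series \<mu> (w @ [u])) p"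
    unfolding comb_series_def append_letter_def
    by (simp add: lext_lin_extend[OF module_fps_const] lext_word[OF module_fps_const])
  also have "\<dots> = lext (\<lambda>c f. fps_const c * f)
      (\<lambda>w. fps_prim \<mu> (s + letter_weight u) (letter_fps \<mu> u * series \<mu> w)) p"
    using assms by (intro lext_cong[OF module_fps_const]) (simp add: series_snoc)
  finally show ?thesis by (simp add: fps_prim_lext comb_series_def)
qed

section \<open>The Euler operator and multiplicativity of the series\<close>

lemma of_rat_complex: "complex_of_rat l = complex_of_real (of_rat l)"
  by (cases l) (simp add: of_rat_rat)

text \<open>Comparison with the real part, where \<open>Re \<mu> > 0\<close> excludes
  cancellation.\<close>

lemma denominator_bound:
  assumes "Re \<mu> > 0" "l > 0"
  shows "norm (of_nat n * \<mu> + of_rat l) \<ge> min (Re \<mu>) (of_rat l) * (real n + 1)"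
proof -
  have "min (Re \<mu>) (of_rat l) * (real n + 1) \<le> real n * Re \<mu> + of_rat l"
    using mult_left_mono[of "min (Re \<mu>) (of_rat l)" "Re \<mu>" "real n"]
    by (simp add: algebra_simps)
  also have "real n * Re \<mu> + of_rat l = Re (of_nat n * \<mu> + of_rat l)"
    by (simp add: of_rat_complex)
  also have "\<dots> \<le> norm (of_nat n * \<mu> + of_rat l)" by (rule complex_Re_le_cmod)
  finally show ?thesis .
qed

lemma denominator_nonzero:
  assumes "Re \<mu> > 0" "l > 0"
  shows "of_nat n * \<mu> + of_rat l \<noteq> (0 :: complex)"
proof -
  have "min (Re \<mu>) (of_rat l) * (real n + 1) > 0" using assms by simp
  then show ?thesis using denominator_bound[OF assms, of n] by auto
qed

definition fps_euler :: "complex \<Rightarrow> rat \<Rightarrow> complex fps \<Rightarrow> complex fps" where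
  "fps_euler \<mu> s f = fps_const (of_rat s) * f + fps_const \<mu> * fps_X * fps_deriv f"

lemma fps_nth_euler: "fps_nth (fps_euler \<mu> s f) n = (of_nat n * \<mu> + of_rat s) * fps_nth f n"
  by (cases n) (simp_all add: fps_euler_def algebra_simps)

text \<open>Leibniz rule: \<open>q d/dq\<close> is a derivation, and the constants \<open>s\<close>
  and \<open>t\<close> are shared between the two factors.\<close>

lemma fps_euler_mult: "fps_euler \<mu> (s + t) (f * g) = fps_euler \<mu> s f * g + f * fps_euler \<mu> t g"
  by (simp add: fps_euler_def of_rat_add algebra_simps flip: fps_const_add)

lemma fps_prim_euler:
  assumes "Re \<mu> > 0" "s > 0"
  shows "fps_prim \<mu> s (fps_euler \<mu> s f) = f" "fps_euler \<mu> s (fps_prim \<mu> s f) = f"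
  using denominator_nonzero[OF assms] by (simp_all add: fps_eq_iff fps_nth_euler fps_prim_def)

text \<open>Both sides have the same image under the Euler operator of the total weight: on the
  product it follows the Leibniz rule, on the shuffle it strips the last letter, and the two
  recursions coincide. As the total weight is positive, the operator is invertible.\<close>

lemma comb_series_shuffle_words:
  assumes "Re \<mu> > 0" "positive_word v" "positive_word w"
  shows "comb_series \<mu> (shuffle_words v w) = series \<mu> v * series \<mu> w"
  using assms(2,3)
proof (induction v w rule: shuffle_words_induct)
  case (snoc v a w b)
  let ?v = "v @ [a]" and ?w = "w @ [b]"
  have pos: "positive_word v" "positive_word w" "weight ?v > 0" "weight ?w > 0"
    using snoc.prems by auto
  have "comb_series \<mu> (append_letter (shuffle_words v ?w) a) =
      fps_prim \<mu> (weight v + weight ?w + letter_weight a)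
        (letter_fps \<mu> a * comb_series \<mu> (shuffle_words v ?w))"
    by (rule comb_series_append_letter) (use keys_shuffle_words pos(1) snoc.prems(2) in blast)
  moreover have "comb_series \<mu> (append_letter (shuffle_words ?v w) b) =
      fps_prim \<mu> (weight ?v + weight w + letter_weight b)
        (letter_fps \<mu> b * comb_series \<mu> (shuffle_words ?v w))"
    by (rule comb_series_append_letter) (use keys_shuffle_words pos(2) snoc.prems(1) in blast)
  ultimately have "comb_series \<mu> (shuffle_words ?v ?w) =
      fps_prim \<mu> (weight ?v + weight ?w)
        (letter_fps \<mu> a * series \<mu> v * series \<mu> ?w + series \<mu> ?v * (letter_fps \<mu> b * series \<mu> w))"
    unfolding shuffle_snoc comb_series_simps
    using snoc.IH(1)[OF pos(1) snoc.prems(2)] snoc.IH(2)[OF snoc.prems(1) pos(2)]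
    by (simp add: fps_prim_add[symmetric] ac_simps)
  also have "letter_fps \<mu> a * series \<mu> v = fps_euler \<mu> (weight ?v) (series \<mu> ?v)"
    unfolding series_snoc using fps_prim_euler(2)[OF assms(1) pos(3)] by simp
  also have "letter_fps \<mu> b * series \<mu> w = fps_euler \<mu> (weight ?w) (series \<mu> ?w)"
    unfolding series_snoc using fps_prim_euler(2)[OF assms(1) pos(4)] by simp
  finally show ?case
    using fps_prim_euler(1)[OF assms(1), of "weight ?v + weight ?w"] pos(3,4)
    by (simp add: fps_euler_mult[symmetric])
qed (simp_all add: comb_series_simps)

lemma comb_series_shuffle:
  assumes "Re \<mu> > 0" "p \<in> H1 \<mu>" "q \<in> H1 \<mu>"
  shows "comb_series \<mu> (shuffle p q) = comb_series \<mu> p * comb_series \<mu> q"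
proof -
  let ?L = "lext (\<lambda>c (f :: complex fps). fps_const c * f)"
  have "comb_series \<mu> (shuffle p q) =
      ?L (\<lambda>v. ?L (\<lambda>w. comb_series \<mu> (shuffle_words v w)) q) p"
    unfolding shuffle_def comb_series_def by (simp add: lext_lin_extend[OF module_fps_const])
  also have "\<dots> = ?L (\<lambda>v. ?L (\<lambda>w. series \<mu> v * series \<mu> w) q) p"
    using assms by (intro lext_cong[OF module_fps_const] comb_series_shuffle_words) (auto simp: H1_eq)
  also have "\<dots> = comb_series \<mu> p * comb_series \<mu> q"
    unfolding comb_series_def lext_def
    by (simp add: sum_product sum_distrib_left mult_ac) (subst sum.swap, simp add: mult_ac)
  finally show ?thesis .
qed

subsection \<open>Nested sums as sums of series coefficients\<close>

definition chain_term :: "complex \<Rightarrow> nat list \<Rightarrow> rat list \<Rightarrow> nat list \<Rightarrow> complex" where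
  "chain_term \<mu> ks ms ns =
     \<mu> ^ length ks / (\<Prod>i<length ks. (of_nat (ns ! i) * \<mu> + of_rat (ms ! i)) ^ (ks ! i))"

text \<open>Index set of the truncated sums. The last entry of a longer chain bounds the remaining
  ones, which is how the depth is lowered by one.\<close>

definition bounded_chains :: "nat \<Rightarrow> nat \<Rightarrow> nat list set" where
  "bounded_chains r n = {ns \<in> weak_chains r. \<forall>x\<in>set ns. x \<le> n}"

lemma finite_bounded_chains [simp]: "finite (bounded_chains r n)"
  by (rule finite_subset[OF _ finite_lists_length_eq[of "{..n}" r]])
     (auto simp: bounded_chains_def weak_chains_def)

lemma length_bounded_chains: "ns \<in> bounded_chains r n \<Longrightarrow> length ns = r"
  by (simp add: bounded_chains_def weak_chains_def)

lemma bounded_chains_0 [simp]: "bounded_chains 0 n = {[]}"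
  by (auto simp: bounded_chains_def weak_chains_def)

lemma weak_chains_Suc_cases:
  assumes "ns \<in> weak_chains (Suc r)"
  obtains ns' n where "ns = ns' @ [n]" "length ns' = r"
  using assms by (cases ns rule: rev_cases) (auto simp: weak_chains_def)

lemma snoc_in_weak_chains:
  "ns @ [n] \<in> weak_chains (Suc r) \<longleftrightarrow> ns \<in> bounded_chains r n"
  by (auto simp: weak_chains_def bounded_chains_def sorted_append)

lemma weak_chains_Suc:
  "bij_betw (\<lambda>(n, ns). ns @ [n]) (SIGMA n:UNIV. bounded_chains r n) (weak_chains (Suc r))"
proof (rule bij_betw_imageI)
  show "(\<lambda>(n, ns). ns @ [n]) ` (SIGMA n:UNIV. bounded_chains r n) = weak_chains (Suc r)"
  proof (intro equalityI subsetI)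
    fix ns assume ns: "ns \<in> weak_chains (Suc r)"
    then obtain ns' n where n: "ns = ns' @ [n]" by (rule weak_chains_Suc_cases)
    then have "(n, ns') \<in> (SIGMA n:UNIV. bounded_chains r n)"
      using ns by (simp add: snoc_in_weak_chains)
    with n show "ns \<in> (\<lambda>(n, ns). ns @ [n]) ` (SIGMA n:UNIV. bounded_chains r n)"
      by (auto intro: rev_image_eqI)
  qed (clarsimp simp: snoc_in_weak_chains)
qed (auto simp: inj_on_def)

lemma bounded_chains_Suc:
  "bij_betw (\<lambda>(n, ns). ns @ [n]) (SIGMA n:{..N}. bounded_chains r n) (bounded_chains (Suc r) N)"
proof (rule bij_betw_imageI)
  have snoc: "ns @ [n] \<in> bounded_chains (Suc r) N \<longleftrightarrow> n \<le> N \<and> ns \<in> bounded_chains r n" for ns n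
    unfolding bounded_chains_def[of "Suc r"] using snoc_in_weak_chains[of ns n r]
    by (auto simp: bounded_chains_def intro: order_trans)
  show "(\<lambda>(n, ns). ns @ [n]) ` (SIGMA n:{..N}. bounded_chains r n) = bounded_chains (Suc r) N"
  proof (intro equalityI subsetI)
    fix ns assume ns: "ns \<in> bounded_chains (Suc r) N"
    then have "ns \<in> weak_chains (Suc r)" by (simp add: bounded_chains_def)
    then obtain ns' n where n: "ns = ns' @ [n]" by (rule weak_chains_Suc_cases)
    then have "(n, ns') \<in> (SIGMA n:{..N}. bounded_chains r n)"
      using ns by (simp add: snoc)
    with n show "ns \<in> (\<lambda>(n, ns). ns @ [n]) ` (SIGMA n:{..N}. bounded_chains r n)"
      by (auto intro: rev_image_eqI)
  qed (clarsimp simp: snoc)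
qed (auto simp: inj_on_def)

lemma sum_bounded_chains_Suc:
  "sum f (bounded_chains (Suc r) N) = (\<Sum>n\<le>N. \<Sum>ns\<in>bounded_chains r n. f (ns @ [n]))"
  by (subst sum.reindex_bij_betw[OF bounded_chains_Suc, symmetric], subst sum.Sigma)
     (auto intro!: sum.cong)

lemma chain_term_snoc:
  assumes "length ks = length ms" "length ns = length ms"
  shows "chain_term \<mu> (ks @ [k]) (ms @ [l]) (ns @ [n]) =
    chain_term \<mu> ks ms ns * (\<mu> / (of_nat n * \<mu> + of_rat l) ^ k)"
proof -
  have "(\<Prod>i<length ks. (of_nat ((ns @ [n]) ! i) * \<mu> + of_rat ((ms @ [l]) ! i)) ^ ((ks @ [k]) ! i)) =
      (\<Prod>i<length ks. (of_nat (ns ! i) * \<mu> + of_rat (ms ! i)) ^ (ks ! i))"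
    using assms by (intro prod.cong) (auto simp: nth_append)
  moreover have "(ns @ [n]) ! length ms = n" "(ks @ [k]) ! length ms = k"
    by (metis assms nth_append_length)+
  ultimately show ?thesis
    using assms by (simp add: chain_term_def lessThan_Suc mult.commute)
qed

lemma series_append_Lx:
  "fps_nth (series \<mu> (w @ replicate i Lx)) n =
    fps_nth (series \<mu> w) n / (of_nat n * \<mu> + of_rat (weight w)) ^ i"
proof (induction i)
  case (Suc i)
  have "w @ replicate (Suc i) Lx = (w @ replicate i Lx) @ [Lx]"
    by (simp add: replicate_append_same)
  then show ?case
    using Suc by (simp add: series_snoc fps_prim_def mult.commute del: append_assoc replicate_Suc)
qed simp

text \<open>Multiplication by \<open>\<mu> / (1 - q)\<close> takes partial sums of the coefficients.
  The letter y and each of the \<open>k - 1\<close> letters x then contribute one division by the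
  same denominator, the weight staying \<open>l\<close> throughout the block.\<close>

lemma series_yx_word_snoc:
  assumes "positive_biindex ks ms" "k \<ge> 1"
  shows "fps_nth (series \<mu> (yx_word_from 0 (ks @ [k]) (ms @ [l]))) n =
    \<mu> / (of_nat n * \<mu> + of_rat l) ^ k * (\<Sum>j\<le>n. fps_nth (series \<mu> (yx_word_from 0 ks ms)) j)"
proof -
  let ?w = "yx_word_from 0 ks ms"
  have wt: "weight ?w = last (0 # ms)" "length ks = length ms"
    using yx_word_from_positive assms(1) by (auto simp: positive_biindex_def)
  have "yx_word_from 0 (ks @ [k]) (ms @ [l]) = (?w @ [Ly (l - weight ?w)]) @ replicate (k - 1) Lx"
    unfolding wt yx_word_from_snoc[OF wt(2)] by simp
  moreover have "weight (?w @ [Ly (l - weight ?w)]) = l" by simp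
  moreover have "fps_nth (Abs_fps (\<lambda>_. \<mu>) * f) n = \<mu> * (\<Sum>j\<le>n. fps_nth f j)" for f
    unfolding mult.commute[of "Abs_fps (\<lambda>_. \<mu>)"]
    by (simp add: fps_mult_nth sum_distrib_left mult.commute atLeast0AtMost)
  ultimately have "fps_nth (series \<mu> (yx_word_from 0 (ks @ [k]) (ms @ [l]))) n =
      \<mu> * (\<Sum>j\<le>n. fps_nth (series \<mu> ?w) j) / (of_nat n * \<mu> + of_rat l) / (of_nat n * \<mu> + of_rat l) ^ (k - 1)"
    by (simp only: series_append_Lx series_snoc letter_fps.simps) (simp add: fps_prim_def)
  also have "\<dots> = \<mu> / (of_nat n * \<mu> + of_rat l) ^ Suc (k - 1) * (\<Sum>j\<le>n. fps_nth (series \<mu> ?w) j)"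
    by simp
  finally show ?thesis using assms(2) by simp
qed

text \<open>Iterating \<open>series_yx_word_snoc\<close> nests the partial sums, each bound becoming
  the next summation variable; this ties the series to truncations of the sums in
  \<open>zeta_mu\<close>.\<close>

lemma sum_series_eq_chains:
  assumes "positive_biindex ks ms"
  shows "(\<Sum>j\<le>n. fps_nth (series \<mu> (yx_word_from 0 ks ms)) j) =
    (\<Sum>ns\<in>bounded_chains (length ks) n. chain_term \<mu> ks ms ns)"
  using assms
proof (induction arbitrary: n rule: positive_biindex_induct)
  case Nil
  have "(\<Sum>j\<le>n. fps_nth (1 :: complex fps) j) = 1" by (simp add: fps_one_nth)
  then show ?case by (simp add: chain_term_def)
next
  case (snoc ks ms k l)
  have len: "length ks = length ms" using snoc(1) by (simp add: positive_biindex_def)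
  have "(\<Sum>ns\<in>bounded_chains (length (ks @ [k])) n. chain_term \<mu> (ks @ [k]) (ms @ [l]) ns) =
      (\<Sum>j\<le>n. \<Sum>ns\<in>bounded_chains (length ks) j. chain_term \<mu> ks ms ns * (\<mu> / (of_nat j * \<mu> + of_rat l) ^ k))"
    by (simp add: sum_bounded_chains_Suc)
       (intro sum.cong refl, subst chain_term_snoc, use len in \<open>auto dest: length_bounded_chains\<close>)
  then show ?case
    unfolding series_yx_word_snoc[OF snoc(1,2)] snoc.IH
    by (simp only: sum_distrib_right[symmetric] mult.commute)
qed

section \<open>Growth of truncated nested sums and absolute convergence\<close>

lemma sum_inverse_sqrt_le: "(\<Sum>j\<le>n. 1 / sqrt (real j + 1)) \<le> 2 * sqrt (real n + 1)"
proof (induction n)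
  case (Suc n)
  define a b where "a = sqrt (real n + 1)" and "b = sqrt (real n + 2)"
  have ab: "a > 0" "b > 0" "a * a + 1 = b * b" by (simp_all add: a_def b_def)
  have "2 * a * b \<le> a * a + b * b" using sum_squares_bound[of a b] by (simp add: power2_eq_square)
  \<comment> \<open>Since \<open>a * a + b * b = 2 * b * b - 1\<close>, this is the previous
    inequality divided by \<open>b\<close>.\<close>
  then have "2 * a + 1 / b \<le> 2 * b"
    using ab by (simp add: field_simps)
  then show ?case using Suc by (simp add: a_def b_def add.commute)
qed simp

lemma norm_letter_factor_le:
  assumes "Re \<mu> > 0" "l > 0"
  obtains K where "K > 0" "\<And>n. norm (\<mu> / (of_nat n * \<mu> + of_rat l) ^ k) \<le> K / (real n + 1) ^ k"
proof -
  define d where "d = min (Re \<mu>) (of_rat l)"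
  have d: "d > 0" using assms by (simp add: d_def)
  have "norm (\<mu> / (of_nat n * \<mu> + of_rat l) ^ k) \<le> (norm \<mu> + 1) / d ^ k / (real n + 1) ^ k" for n
  proof -
    have "(d * (real n + 1)) ^ k \<le> norm (of_nat n * \<mu> + of_rat l) ^ k"
      using denominator_bound[OF assms, of n] d by (intro power_mono) (auto simp: d_def)
    then have "norm \<mu> / norm (of_nat n * \<mu> + of_rat l) ^ k \<le> (norm \<mu> + 1) / (d * (real n + 1)) ^ k"
      using d by (intro frac_le) auto
    then show ?thesis by (simp add: norm_divide norm_power power_mult_distrib)
  qed
  moreover have "(norm \<mu> + 1) / d ^ k > 0"
    using d norm_ge_zero[of \<mu>] by (intro divide_pos_pos) (auto simp: add_nonneg_pos)
  ultimately show ?thesis using that by blast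
qed

text \<open>The true growth is at most a power of the logarithm depending on the depth. The cruder
  exponent 1/2 reproduces itself: a further factor of order \<open>1 / (n + 1)\<close> turns the
  bound into a sum of inverse square roots, again of order \<open>sqrt\<close>.\<close>

lemma sum_norm_chain_term_le:
  assumes "positive_biindex ks ms" "Re \<mu> > 0"
  shows "\<exists>C\<ge>0. \<forall>n. (\<Sum>ns\<in>bounded_chains (length ks) n. norm (chain_term \<mu> ks ms ns)) \<le> C * sqrt (real n + 1)"
  using assms(1)
proof (induction rule: positive_biindex_induct)
  case Nil
  show ?case by (intro exI[of _ 1]) (simp add: chain_term_def)
next
  case (snoc ks ms k l)
  have len: "length ks = length ms" using snoc(1) by (simp add: positive_biindex_def)
  obtain C where C: "C \<ge> 0"
    "\<And>n. (\<Sum>ns\<in>bounded_chains (length ks) n. norm (chain_term \<mu> ks ms ns)) \<le> C * sqrt (real n + 1)"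
    using snoc.IH by blast
  obtain K where K: "K > 0" "\<And>n. norm (\<mu> / (of_nat n * \<mu> + of_rat l) ^ k) \<le> K / (real n + 1) ^ k"
    using norm_letter_factor_le[OF assms(2) snoc(3)] by metis
  have "(\<Sum>ns\<in>bounded_chains (length (ks @ [k])) n. norm (chain_term \<mu> (ks @ [k]) (ms @ [l]) ns))
      \<le> (2 * C * K) * sqrt (real n + 1)" for n
  proof -
    have "(\<Sum>ns\<in>bounded_chains (length (ks @ [k])) n. norm (chain_term \<mu> (ks @ [k]) (ms @ [l]) ns)) =
      (\<Sum>j\<le>n. (\<Sum>ns\<in>bounded_chains (length ks) j. norm (chain_term \<mu> ks ms ns)) *
        norm (\<mu> / (of_nat j * \<mu> + of_rat l) ^ k))"
      by (simp add: sum_bounded_chains_Suc sum_distrib_right)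
         (intro sum.cong refl, subst chain_term_snoc, use len in \<open>auto dest: length_bounded_chains simp: norm_mult norm_divide\<close>)
    also have "\<dots> \<le> (\<Sum>j\<le>n. C * K * (1 / sqrt (real j + 1)))"
    proof (rule sum_mono)
      fix j
      have "real j + 1 \<le> (real j + 1) ^ k"
        using snoc(2) by (intro self_le_power) auto
      then have "K / (real j + 1) ^ k \<le> K / (real j + 1)"
        using K(1) by (intro divide_left_mono) auto
      with K(2)[of j] have k: "norm (\<mu> / (of_nat j * \<mu> + of_rat l) ^ k) \<le> K / (real j + 1)" by linarith
      have "(\<Sum>ns\<in>bounded_chains (length ks) j. norm (chain_term \<mu> ks ms ns)) *
          norm (\<mu> / (of_nat j * \<mu> + of_rat l) ^ k) \<le> (C * sqrt (real j + 1)) * (K / (real j + 1))"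
        using C k by (intro mult_mono) auto
      also have "\<dots> = C * K * (1 / sqrt (real j + 1))"
        by (simp add: field_simps)
      finally show "(\<Sum>ns\<in>bounded_chains (length ks) j. norm (chain_term \<mu> ks ms ns)) *
          norm (\<mu> / (of_nat j * \<mu> + of_rat l) ^ k) \<le> C * K * (1 / sqrt (real j + 1))" .
    qed
    also have "\<dots> = C * K * (\<Sum>j\<le>n. 1 / sqrt (real j + 1))" by (simp only: sum_distrib_left)
    also have "\<dots> \<le> C * K * (2 * sqrt (real n + 1))"
      using C(1) K(1) sum_inverse_sqrt_le[of n] by (intro mult_left_mono) auto
    finally show ?thesis by (simp add: mult_ac)
  qed
  then show ?case using C(1) K(1) by (intro exI[of _ "2 * C * K"]) simp
qed

text \<open>The exponent is 1/2 - 2: partial sums of order \<open>sqrt (n + 1)\<close> times a last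
  factor of order \<open>(n + 1)\<close> to the power -2.\<close>

definition fast_decay :: "(nat \<Rightarrow> complex) \<Rightarrow> bool" where
  "fast_decay b \<longleftrightarrow> (\<exists>C. \<forall>n. norm (b n) \<le> C * (real n + 1) powr (-3/2))"

lemma summable_Suc_powr: "s < - 1 \<Longrightarrow> summable (\<lambda>n. (real n + 1) powr s)"
  using summable_real_powr_iff[of s] summable_Suc_iff[of "\<lambda>n. real n powr s"]
  by (simp add: add.commute)

lemma fast_decay_summable_norm:
  assumes "fast_decay b"
  shows "summable (\<lambda>n. norm (b n))"
proof -
  obtain C where "\<And>n. norm (b n) \<le> C * (real n + 1) powr (-3/2)"
    using assms unfolding fast_decay_def by blast
  then show ?thesis
    by (intro summable_comparison_test[OF _ summable_mult[OF summable_Suc_powr[of "-3/2"], of C]]) auto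
qed

text \<open>Common treatment of \<open>zeta_mu\<close> and \<open>D_mu\<close>, which differ only in
  the factor \<open>g\<close> at the largest index. Absolute summability permits summing the
  unordered family fibre by fibre over the last entry.\<close>

lemma infsum_weak_chains:
  assumes "positive_biindex ks ms" "Re \<mu> > 0" "\<And>n. norm (g n) \<le> K / (real n + 1) ^ 2"
  defines "b \<equiv> \<lambda>n. g n * (\<Sum>j\<le>n. fps_nth (series \<mu> (yx_word_from 0 ks ms)) j)"
  shows "fast_decay b"
    "(\<Sum>\<^sub>\<infinity>ns\<in>weak_chains (Suc (length ks)). chain_term \<mu> ks ms (butlast ns) * g (last ns)) = suminf b"
proof -
  let ?T = "chain_term \<mu> ks ms" and ?B = "bounded_chains (length ks)"
  obtain C where C: "C \<ge> 0" "\<And>n. (\<Sum>ns\<in>?B n. norm (?T ns)) \<le> C * sqrt (real n + 1)"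
    using sum_norm_chain_term_le[OF assms(1,2)] by blast
  have b: "b n = (\<Sum>ns\<in>?B n. ?T ns * g n)" for n
    by (simp add: b_def sum_series_eq_chains[OF assms(1)] sum_distrib_left mult.commute)
  have bd: "(\<Sum>ns\<in>?B n. norm (?T ns * g n)) \<le> (C * K) * (real n + 1) powr (-3/2)" for n
  proof -
    have "(\<Sum>ns\<in>?B n. norm (?T ns * g n)) = (\<Sum>ns\<in>?B n. norm (?T ns)) * norm (g n)"
      by (simp add: norm_mult sum_distrib_right)
    also have "\<dots> \<le> (C * sqrt (real n + 1)) * (K / (real n + 1) ^ 2)"
      using C assms(3) by (intro mult_mono) auto
    also have "\<dots> = (C * K) * ((real n + 1) powr (1/2) / (real n + 1) powr 2)"
      by (simp add: powr_half_sqrt)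
    also have "(real n + 1) powr (1/2) / (real n + 1) powr 2 = (real n + 1) powr (-3/2)"
      by (subst powr_diff[symmetric]) simp
    finally show ?thesis .
  qed
  have "norm (b n) \<le> (C * K) * (real n + 1) powr (-3/2)" for n
    unfolding b using bd[of n] norm_sum[of "\<lambda>ns. ?T ns * g n" "?B n"] by linarith
  then show fd: "fast_decay b" unfolding fast_decay_def by blast
  have sm: "summable (\<lambda>n. \<Sum>ns\<in>?B n. norm (?T ns * g n))"
    using bd by (intro summable_comparison_test[OF _ summable_mult[OF summable_Suc_powr[of "-3/2"], of "C * K"]])
      (auto simp: sum_nonneg)
  have "(\<lambda>n. norm (\<Sum>ns\<in>?B n. norm (?T ns * g n))) summable_on UNIV"
    using sm by (intro norm_summable_imp_summable_on) (simp add: sum_nonneg)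
  then have "(\<lambda>x. norm (case x of (n, ns) \<Rightarrow> ?T ns * g n)) summable_on (SIGMA n:UNIV. ?B n)"
    by (subst Infinite_Sum.abs_summable_on_Sigma_iff) simp
  then have sS: "(\<lambda>(n, ns). ?T ns * g n) summable_on (SIGMA n:UNIV. ?B n)"
    by (rule Infinite_Sum.abs_summable_summable)
  have "(\<Sum>\<^sub>\<infinity>ns\<in>weak_chains (Suc (length ks)). ?T (butlast ns) * g (last ns)) =
      (\<Sum>\<^sub>\<infinity>(n, ns)\<in>(SIGMA n:UNIV. ?B n). ?T ns * g n)"
    by (subst infsum_reindex_bij_betw[OF weak_chains_Suc, symmetric]) (auto intro!: infsum_cong)
  also have "\<dots> = (\<Sum>\<^sub>\<infinity>n. \<Sum>\<^sub>\<infinity>ns\<in>?B n. ?T ns * g n)"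
    by (rule infsum_Sigma'_banach[OF sS, symmetric])
  also have "\<dots> = (\<Sum>\<^sub>\<infinity>n. b n)"
    by (simp add: b)
  also have "\<dots> = suminf b"
    using fast_decay_summable_norm[OF fd]
    by (metis infsumI norm_summable_imp_has_sum summable_norm_cancel summable_sums)
  finally show "(\<Sum>\<^sub>\<infinity>ns\<in>weak_chains (Suc (length ks)). ?T (butlast ns) * g (last ns)) = suminf b" .
qed

lemma zeta_mu_eq_suminf:
  assumes "admissible ks ms" "Re \<mu> > 0"
  shows "fast_decay (fps_nth (series \<mu> (yx_word_from 0 ks ms)))"
    "zeta_mu \<mu> ks ms = suminf (fps_nth (series \<mu> (yx_word_from 0 ks ms)))"
proof -
  obtain ks' k where ks: "ks = ks' @ [k]"
    using assms by (cases ks rule: rev_cases) (auto simp: admissible_def)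
  then obtain ms' l where ms: "ms = ms' @ [l]"
    using assms by (cases ms rule: rev_cases) (auto simp: admissible_def positive_biindex_def)
  have p: "positive_biindex ks' ms'" "l > 0" "k \<ge> 2" "length ks' = length ms'"
    using assms(1) by (auto simp: ks ms admissible_def positive_biindex_def)
  obtain K where K: "K > 0" "\<And>n. norm (\<mu> / (of_nat n * \<mu> + of_rat l) ^ k) \<le> K / (real n + 1) ^ k"
    using norm_letter_factor_le[OF assms(2) p(2)] by metis
  have "norm (\<mu> / (of_nat n * \<mu> + of_rat l) ^ k) \<le> K / (real n + 1) ^ 2" for n
  proof -
    have "(real n + 1) ^ 2 \<le> (real n + 1) ^ k" using p(3) by (intro power_increasing) auto
    then have "K / (real n + 1) ^ k \<le> K / (real n + 1) ^ 2"
      using K(1) by (intro divide_left_mono) auto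
    with K(2)[of n] show ?thesis by linarith
  qed
  note * = infsum_weak_chains[OF p(1) assms(2) this]
  have series: "fps_nth (series \<mu> (yx_word_from 0 ks ms)) = (\<lambda>n. \<mu> / (of_nat n * \<mu> + of_rat l) ^ k *
      (\<Sum>j\<le>n. fps_nth (series \<mu> (yx_word_from 0 ks' ms')) j))"
    unfolding ks ms using p(3) by (intro ext series_yx_word_snoc[OF p(1)]) simp
  show "fast_decay (fps_nth (series \<mu> (yx_word_from 0 ks ms)))"
    unfolding series by (rule *(1))
  have "zeta_mu \<mu> ks ms = infsum (chain_term \<mu> ks ms) (weak_chains (Suc (length ks')))"
    by (simp add: zeta_mu_def chain_term_def[abs_def] ks)
  also have "\<dots> = (\<Sum>\<^sub>\<infinity>ns\<in>weak_chains (Suc (length ks')).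
      chain_term \<mu> ks' ms' (butlast ns) * (\<mu> / (of_nat (last ns) * \<mu> + of_rat l) ^ k))"
  proof (rule infsum_cong)
    fix ns assume "ns \<in> weak_chains (Suc (length ks'))"
    then obtain ns' n where "ns = ns' @ [n]" "length ns' = length ks'"
      by (rule weak_chains_Suc_cases)
    then show "chain_term \<mu> ks ms ns =
        chain_term \<mu> ks' ms' (butlast ns) * (\<mu> / (of_nat (last ns) * \<mu> + of_rat l) ^ k)"
      using p(4) by (simp add: ks ms chain_term_snoc)
  qed
  finally show "zeta_mu \<mu> ks ms = suminf (fps_nth (series \<mu> (yx_word_from 0 ks ms)))"
    unfolding series *(2) .
qed

text \<open>Each word alone has a last factor of order \<open>1 / n\<close> only; by partial
  fractions the difference of the two is of order \<open>n\<close> to the power -2.\<close>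

lemma D_mu_eq_suminf:
  assumes "special_triple ks ms ms'" "Re \<mu> > 0"
  defines "f \<equiv> series \<mu> (yx_word_from 0 ks ms) - series \<mu> (yx_word_from 0 ks ms')"
  shows "fast_decay (fps_nth f)" "D_mu \<mu> ks ms ms' = suminf (fps_nth f)"
proof -
  obtain ks0 where ks: "ks = ks0 @ [1]"
    using assms by (cases ks rule: rev_cases) (auto simp: special_triple_def)
  then obtain ms0 l where ms: "ms = ms0 @ [l]"
    using assms by (cases ms rule: rev_cases) (auto simp: special_triple_def positive_biindex_def)
  then obtain l' where ms': "ms' = ms0 @ [l']"
    using assms ks
    by (cases ms' rule: rev_cases) (auto simp: special_triple_def positive_biindex_def)
  have p: "positive_biindex ks0 ms0" "l > 0" "l' > 0" "length ks0 = length ms0"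
    using assms(1) by (auto simp: ks ms ms' special_triple_def positive_biindex_def)
  let ?d = "\<lambda>l n. of_nat n * \<mu> + of_rat l"
  define g where "g = (\<lambda>n. of_rat (l' - l) * (\<mu> / (?d l n * ?d l' n)))"
  obtain K where K: "K > 0" "\<And>n. norm (\<mu> / ?d l n ^ 1) \<le> K / (real n + 1) ^ 1"
    using norm_letter_factor_le[OF assms(2) p(2)] by metis
  obtain K' where K': "K' > 0" "\<And>n. norm (\<mu> / ?d l' n ^ 1) \<le> K' / (real n + 1) ^ 1"
    using norm_letter_factor_le[OF assms(2) p(3)] by metis
  have mu: "\<mu> \<noteq> 0" using assms(2) by auto
  have "norm (g n) \<le> (norm (of_rat (l' - l) / \<mu>) * (K * K')) / (real n + 1) ^ 2" for n
  proof -
    \<comment> \<open>A second \<open>\<mu>\<close> is supplied, and divided off in front, so that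
      the bound for a single letter applies to both fractions.\<close>
    have "g n = of_rat (l' - l) / \<mu> * ((\<mu> / ?d l n) * (\<mu> / ?d l' n))"
      using mu by (simp add: g_def)
    also have "norm \<dots> = norm (of_rat (l' - l) / \<mu>) * (norm (\<mu> / ?d l n) * norm (\<mu> / ?d l' n))"
      by (simp only: norm_mult)
    also have "\<dots> \<le> norm (of_rat (l' - l) / \<mu>) * ((K / (real n + 1)) * (K' / (real n + 1)))"
      using K K' by (intro mult_left_mono mult_mono) auto
    finally show ?thesis by (simp add: power2_eq_square)
  qed
  note * = infsum_weak_chains[OF p(1) assms(2) this]
  have g: "g n = \<mu> / ?d l n ^ 1 - \<mu> / ?d l' n ^ 1" for n
    unfolding g_def using denominator_nonzero[OF assms(2) p(2), of n] denominator_nonzero[OF assms(2) p(3), of n]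
    by (simp add: field_simps of_rat_diff)
  have series: "fps_nth f = (\<lambda>n. g n * (\<Sum>j\<le>n. fps_nth (series \<mu> (yx_word_from 0 ks0 ms0)) j))"
    unfolding f_def ks ms ms' fps_sub_nth series_yx_word_snoc[OF p(1) order_refl] g left_diff_distrib ..
  show "fast_decay (fps_nth f)"
    unfolding series by (rule *(1))
  have "D_mu \<mu> ks ms ms' = (\<Sum>\<^sub>\<infinity>ns\<in>weak_chains (Suc (length ks0)). of_rat (l' - l) *
      (\<mu> ^ length ks / ((\<Prod>i<length ks - 1. (of_nat (ns ! i) * \<mu> + of_rat (ms ! i)) ^ (ks ! i)) *
         (of_nat (last ns) * \<mu> + of_rat (last ms)) * (of_nat (last ns) * \<mu> + of_rat (last ms')))))"
    unfolding D_mu_def by (subst infsum_cmult_right') (simp add: ks ms ms')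
  also have "\<dots> = (\<Sum>\<^sub>\<infinity>ns\<in>weak_chains (Suc (length ks0)). chain_term \<mu> ks0 ms0 (butlast ns) * g (last ns))"
  proof (rule infsum_cong)
    fix ns assume "ns \<in> weak_chains (Suc (length ks0))"
    then obtain ns' n where ns: "ns = ns' @ [n]" "length ns' = length ks0"
      by (rule weak_chains_Suc_cases)
    have "(\<Prod>i<length ks - 1. (of_nat (ns ! i) * \<mu> + of_rat (ms ! i)) ^ (ks ! i)) =
        (\<Prod>i<length ks0. (of_nat (ns' ! i) * \<mu> + of_rat (ms0 ! i)) ^ (ks0 ! i))"
      using ns p(4) by (intro prod.cong) (auto simp: ks ms nth_append)
    then show "of_rat (l' - l) *
      (\<mu> ^ length ks / ((\<Prod>i<length ks - 1. (of_nat (ns ! i) * \<mu> + of_rat (ms ! i)) ^ (ks ! i)) *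
         (of_nat (last ns) * \<mu> + of_rat (last ms)) * (of_nat (last ns) * \<mu> + of_rat (last ms')))) =
        chain_term \<mu> ks0 ms0 (butlast ns) * g (last ns)"
      by (simp add: chain_term_def ns ms ms' g_def ks mult.assoc mult.left_commute)
  qed
  finally show "D_mu \<mu> ks ms ms' = suminf (fps_nth f)"
    unfolding series *(2) .
qed

subsection \<open>Behaviour of the series at the boundary point\<close>

lemma fps_conv_radius_bounded:
  fixes f :: "complex fps"
  assumes "\<And>n. norm (fps_nth f n) \<le> C"
  shows "fps_conv_radius f \<ge> 1"
  unfolding fps_conv_radius_def
proof (rule conv_radius_geI_ex')
  fix r :: real assume r: "0 < r" "ereal r < 1"
  then have r1: "r < 1" by simp
  show "summable (\<lambda>n. fps_nth f n * of_real r ^ n)"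
  proof (rule summable_comparison_test[OF _ summable_mult[OF summable_geometric[of r], of C]])
    show "\<exists>N. \<forall>n\<ge>N. norm (fps_nth f n * of_real r ^ n) \<le> C * r ^ n"
      using assms r(1) by (auto simp: norm_mult norm_power intro!: mult_right_mono)
  qed (use r r1 in simp)
qed

text \<open>The coefficients are bounded: partial sums grow at most like \<open>n + 1\<close>, and
  the last block divides by at least that order.\<close>

lemma series_conv_radius:
  assumes "Re \<mu> > 0" "positive_word w"
  shows "fps_conv_radius (series \<mu> w) \<ge> 1"
proof -
  obtain ks ms where k: "positive_biindex ks ms" "w = yx_word_from 0 ks ms"
    using positive_word_cases_biindex[OF assms(2)] .
  show ?thesis
  proof (cases ks rule: rev_cases)
    case Nil
    then show ?thesis using k by simp
  next
    case (snoc ks' i)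
    then obtain ms' l where ms: "ms = ms' @ [l]"
      using k(1) by (cases ms rule: rev_cases) (auto simp: positive_biindex_def)
    have p: "positive_biindex ks' ms'" "i \<ge> 1" "l > 0"
      using k(1) by (simp_all add: snoc ms positive_biindex_snoc)
    obtain C where C: "C \<ge> 0" "\<And>n. (\<Sum>ns\<in>bounded_chains (length ks') n. norm (chain_term \<mu> ks' ms' ns))
        \<le> C * sqrt (real n + 1)"
      using sum_norm_chain_term_le[OF p(1) assms(1)] by blast
    obtain K where K: "K > 0" "\<And>n. norm (\<mu> / (of_nat n * \<mu> + of_rat l) ^ i) \<le> K / (real n + 1) ^ i"
      using norm_letter_factor_le[OF assms(1) p(3)] by metis
    have "norm (fps_nth (series \<mu> w) n) \<le> K * C" for n
    proof -
      have "norm (\<Sum>j\<le>n. fps_nth (series \<mu> (yx_word_from 0 ks' ms')) j) \<le> C * sqrt (real n + 1)"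
        unfolding sum_series_eq_chains[OF p(1)] using C(2)[of n] norm_sum order_trans by blast
      moreover have "sqrt (real n + 1) \<le> real n + 1"
        by (rule real_le_lsqrt) (auto simp: power2_eq_square)
      ultimately have S: "norm (\<Sum>j\<le>n. fps_nth (series \<mu> (yx_word_from 0 ks' ms')) j) \<le> C * (real n + 1)"
        using C(1) by (meson mult_left_mono order_trans)
      have "real n + 1 \<le> (real n + 1) ^ i"
        using p(2) by (intro self_le_power) auto
      then have "K / (real n + 1) ^ i \<le> K / (real n + 1)"
        using K(1) by (intro divide_left_mono) auto
      with K(2)[of n] have "norm (\<mu> / (of_nat n * \<mu> + of_rat l) ^ i) \<le> K / (real n + 1)" by linarith
      with S have "norm (\<mu> / (of_nat n * \<mu> + of_rat l) ^ i) *
          norm (\<Sum>j\<le>n. fps_nth (series \<mu> (yx_word_from 0 ks' ms')) j) \<le> K / (real n + 1) * (C * (real n + 1))"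
        using K(1) by (intro mult_mono) auto
      also have "\<dots> = K * C" by (simp add: field_simps)
      finally show ?thesis
        unfolding k(2) snoc ms series_yx_word_snoc[OF p(1,2)] norm_mult .
    qed
    then show ?thesis by (rule fps_conv_radius_bounded)
  qed
qed

lemma comb_series_conv_radius:
  assumes "Re \<mu> > 0" "p \<in> H1 \<mu>"
  shows "fps_conv_radius (comb_series \<mu> p) \<ge> 1"
proof -
  let ?V = "{p. fps_conv_radius (comb_series \<mu> p) \<ge> 1}"
  have "closed_over (rat_adjoin \<mu>) scale_comb ?V"
    unfolding closed_over_def
  proof (intro conjI ballI)
    show "0 \<in> ?V" by (simp add: comb_series_def lext_zero[OF module_fps_const])
  next
    fix v w assume "v \<in> ?V" "w \<in> ?V"
    then show "v + w \<in> ?V"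
      using fps_conv_radius_add[of "comb_series \<mu> v" "comb_series \<mu> w"]
      by (auto simp: comb_series_simps intro: order_trans[rotated])
  next
    fix c v assume "v \<in> ?V"
    then show "scale_comb c v \<in> ?V"
      using fps_conv_radius_mult[of "fps_const c" "comb_series \<mu> v"]
      by (auto simp: comb_series_simps intro: order_trans[rotated])
  qed
  moreover have "word ` words1 \<subseteq> ?V"
    using series_conv_radius[OF assms(1)] by (auto simp: words1_eq comb_series_simps)
  ultimately have "H1 \<mu> \<subseteq> ?V"
    unfolding H1_def by (rule span_over_least)
  then show ?thesis using assms(2) by blast
qed

text \<open>The left side is at most \<open>min 1 x\<close> for
  \<open>x = (n + 1) * (1 - q)\<close>, by Bernoulli's inequality, and \<open>min 1 x\<close> is at
  most \<open>x powr (1/4)\<close>.\<close>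

lemma one_minus_power_le:
  fixes q :: real
  assumes "0 \<le> q" "q \<le> 1"
  shows "1 - q ^ n \<le> ((real n + 1) * (1 - q)) powr (1/4)"
proof (cases "(real n + 1) * (1 - q) \<le> 1")
  case True
  have "1 - q ^ n \<le> real n * (1 - q)"
    using Bernoulli_inequality[of "q - 1" n] assms by (simp add: algebra_simps)
  also have "\<dots> \<le> (real n + 1) * (1 - q)"
    using assms by (intro mult_right_mono) auto
  also have "\<dots> \<le> ((real n + 1) * (1 - q)) powr (1/4)"
  proof (cases "q = 1")
    case False
    then show ?thesis
      using powr_mono'[of "1/4" 1 "(real n + 1) * (1 - q)"] True assms by simp
  qed simp
  finally show ?thesis .
next
  case False
  have "1 - q ^ n \<le> 1" using assms by simp
  also have "\<dots> \<le> ((real n + 1) * (1 - q)) powr (1/4)"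
    using False by (intro ge_one_powr_ge_zero) auto
  finally show ?thesis .
qed

text \<open>Abel's limit theorem with a rate that beats every power of a logarithm.\<close>

lemma abel_fast_decay:
  assumes "fast_decay (fps_nth f)"
  obtains C where "\<And>q. 0 < q \<Longrightarrow> q < 1 \<Longrightarrow>
    norm (eval_fps f (of_real q) - suminf (fps_nth f)) \<le> C * (1 - q) powr (1/4)"
proof -
  let ?b = "fps_nth f"
  obtain C where C: "\<And>n. norm (?b n) \<le> C * (real n + 1) powr (-3/2)"
    using assms unfolding fast_decay_def by blast
  have C0: "C \<ge> 0" using order_trans[OF norm_ge_zero C[of 0]] by simp
  \<comment> \<open>The exponent is -3/2 + 1/4: a quarter power of \<open>n + 1\<close> is given
    away for the rate in \<open>1 - q\<close>, and the series still converges.\<close>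
  let ?S = "suminf (\<lambda>n::nat. (real n + 1) powr (-5/4))"
  show ?thesis
  proof (rule that[of "C * ?S"])
    fix q :: real assume q: "0 < q" "q < 1"
    have sb: "summable (\<lambda>n. norm (?b n))" by (rule fast_decay_summable_norm[OF assms])
    have sq: "summable (\<lambda>n. norm (?b n * of_real q ^ n))"
    proof (rule summable_comparison_test[OF _ sb], intro exI allI impI)
      fix n :: nat
      show "norm (norm (?b n * of_real q ^ n)) \<le> norm (?b n)"
        using q by (simp add: norm_mult norm_power mult_left_le power_le_one)
    qed
    have "eval_fps f (of_real q) - suminf ?b = suminf (\<lambda>n. ?b n * of_real q ^ n - ?b n)"
      unfolding eval_fps_def
      by (rule suminf_diff[OF summable_norm_cancel[OF sq] summable_norm_cancel[OF sb]])
    moreover have bd: "norm (?b n * of_real q ^ n - ?b n) \<le> C * (1 - q) powr (1/4) * (real n + 1) powr (-5/4)" for n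
    proof -
      have "?b n * of_real q ^ n - ?b n = ?b n * of_real (q ^ n - 1)"
        by (simp add: algebra_simps)
      also have "norm \<dots> = norm (?b n) * (1 - q ^ n)"
        unfolding norm_mult norm_of_real using q power_le_one[of q n] by simp
      also have "\<dots> \<le> (C * (real n + 1) powr (-3/2)) * ((real n + 1) * (1 - q)) powr (1/4)"
        using q C C0 one_minus_power_le[of q n] power_le_one[of q n] by (intro mult_mono) auto
      also have "\<dots> = C * (1 - q) powr (1/4) * ((real n + 1) powr (-3/2) * (real n + 1) powr (1/4))"
        using q by (simp add: powr_mult)
      also have "(real n + 1) powr (-3/2) * (real n + 1) powr (1/4) = (real n + 1) powr (-5/4)"
        by (simp add: powr_add[symmetric])
      finally show ?thesis .
    qed
    moreover have "norm (suminf (\<lambda>n. ?b n * of_real q ^ n - ?b n)) \<le>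
        suminf (\<lambda>n. C * (1 - q) powr (1/4) * (real n + 1) powr (-5/4))"
      by (intro norm_suminf_le bd summable_mult summable_Suc_powr) simp
    moreover have "suminf (\<lambda>n. C * (1 - q) powr (1/4) * (real n + 1) powr (-5/4)) = C * (1 - q) powr (1/4) * ?S"
      by (intro suminf_mult summable_Suc_powr) simp
    ultimately show "norm (eval_fps f (of_real q) - suminf ?b) \<le> C * ?S * (1 - q) powr (1/4)"
      by (simp add: mult_ac)
  qed
qed

text \<open>For \<open>e = 1\<close>, compare \<open>n + 1\<close> copies of \<open>q ^ n\<close>
  with the geometric sum; then raise to the power \<open>e\<close>, using
  \<open>q ^ n \<le> 1\<close>.\<close>

lemma power_times_Suc_le:
  fixes q :: real
  assumes "0 < q" "q < 1" "0 < e" "e \<le> 1"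
  shows "(real n + 1) powr e * q ^ n \<le> (1 - q) powr (- e)"
proof -
  have "(real n + 1) * q ^ n = (\<Sum>j\<le>n. q ^ n)" by simp
  also have "\<dots> \<le> (\<Sum>j\<le>n. q ^ j)"
    using assms by (intro sum_mono power_decreasing) auto
  also have "\<dots> = (1 - q ^ Suc n) / (1 - q)"
    using assms sum_gp_strict[of q "Suc n"] by (simp add: lessThan_Suc_atMost)
  also have "\<dots> \<le> 1 / (1 - q)"
    using assms by (intro divide_right_mono) auto
  finally have le: "(real n + 1) * q ^ n \<le> 1 / (1 - q)" .
  have "q ^ n \<le> (q ^ n) powr e"
    using powr_mono'[of e 1 "q ^ n"] assms power_le_one[of q n] by simp
  then have "(real n + 1) powr e * q ^ n \<le> (real n + 1) powr e * (q ^ n) powr e"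
    by (intro mult_left_mono) auto
  also have "\<dots> = ((real n + 1) * q ^ n) powr e"
    using assms by (simp add: powr_mult)
  also have "\<dots> \<le> (1 / (1 - q)) powr e"
    using le assms by (intro powr_mono2) auto
  finally show ?thesis
    using assms by (simp add: powr_divide powr_minus_divide)
qed

section \<open>The series of the letter \<open>y_m\<close> near the boundary point\<close>

context
  fixes \<mu> :: complex and m :: rat
  assumes re: "Re \<mu> > 0" and m: "m > 0"
begin

lemma series_letter_nth: "fps_nth (series \<mu> [Ly m]) n = \<mu> / (of_nat n * \<mu> + of_rat m)"
  using series_yx_word_snoc[of "[]" "[]" 1 \<mu> m n] by (simp add: positive_biindex_def fps_one_nth)

lemma positive_word_letter: "positive_word [Ly m]"
  using positive_word_append_Ly[of "[]" m 1] m by simp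

definition ev :: "word_comb \<Rightarrow> real \<Rightarrow> complex" where
  "ev p q = eval_fps (comb_series \<mu> p) (of_real q)"

abbreviation (input) T_ev :: "real \<Rightarrow> complex" where
  "T_ev \<equiv> ev (word [Ly m])"

lemma in_radius:
  assumes "p \<in> H1 \<mu>" "0 < q" "q < 1"
  shows "ereal (norm (complex_of_real q)) < fps_conv_radius (comb_series \<mu> p)"
proof -
  have "ereal (norm (complex_of_real q)) < 1" using assms by simp
  also have "1 \<le> fps_conv_radius (comb_series \<mu> p)"
    by (rule comb_series_conv_radius[OF re assms(1)])
  finally show ?thesis .
qed

lemma ev_add:
  "v \<in> H1 \<mu> \<Longrightarrow> w \<in> H1 \<mu> \<Longrightarrow> 0 < q \<Longrightarrow> q < 1 \<Longrightarrow> ev (v + w) q = ev v q + ev w q"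
  unfolding ev_def comb_series_simps by (intro eval_fps_add in_radius)

lemma ev_scale:
  "v \<in> H1 \<mu> \<Longrightarrow> 0 < q \<Longrightarrow> q < 1 \<Longrightarrow> ev (scale_comb c v) q = c * ev v q"
  unfolding ev_def comb_series_simps by (subst eval_fps_mult[OF _ in_radius]) auto

lemma ev_shuffle:
  "v \<in> H1 \<mu> \<Longrightarrow> w \<in> H1 \<mu> \<Longrightarrow> 0 < q \<Longrightarrow> q < 1 \<Longrightarrow> ev (shuffle v w) q = ev v q * ev w q"
  unfolding ev_def comb_series_shuffle[OF re] by (intro eval_fps_mult in_radius)

lemma eventually_unit_interval: "eventually (\<lambda>q :: real. 0 < q \<and> q < 1) (at_left 1)"
  using eventually_at_left_real[of 0 1] by (auto elim: eventually_mono)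

lemma T_ev_sums:
  assumes "0 < q" "q < 1"
  shows "(\<lambda>n. \<mu> / (of_nat n * \<mu> + of_rat m) * of_real q ^ n) sums T_ev q"
  using sums_eval_fps[OF in_radius[OF word_in_H1[OF positive_word_letter] assms]]
  by (simp add: ev_def comb_series_simps series_letter_nth)

text \<open>The growth is logarithmic, but any small power is enough later on. It is obtained by
  splitting \<open>1 / (n + 1)\<close> into a summable power and \<open>(n + 1) powr e\<close>,
  which \<open>q ^ n\<close> absorbs.\<close>

lemma T_ev_le:
  assumes "0 < e" "e \<le> 1"
  obtains C where "\<And>q. 0 < q \<Longrightarrow> q < 1 \<Longrightarrow> norm (T_ev q) \<le> C * (1 - q) powr (- e)"
proof -
  obtain K where K: "K > 0" "\<And>n. norm (\<mu> / (of_nat n * \<mu> + of_rat m) ^ 1) \<le> K / (real n + 1) ^ 1"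
    using norm_letter_factor_le[OF re m] by metis
  let ?S = "suminf (\<lambda>n::nat. (real n + 1) powr (- 1 - e))"
  show ?thesis
  proof (rule that[of "K * ?S"])
    fix q :: real assume q: "0 < q" "q < 1"
    have bd: "norm (\<mu> / (of_nat n * \<mu> + of_rat m) * of_real q ^ n) \<le>
        K * (1 - q) powr (- e) * (real n + 1) powr (- 1 - e)" for n
    proof -
      have "(real n + 1) powr (- 1 - e) * (real n + 1) powr e = 1 / (real n + 1)"
        by (simp add: powr_add[symmetric] powr_minus_divide)
      then have "K * q ^ n * ((real n + 1) powr (- 1 - e) * (real n + 1) powr e) =
          K * q ^ n * (1 / (real n + 1))"
        by (simp only:)
      then have eq: "K / (real n + 1) * q ^ n =
          K * (real n + 1) powr (- 1 - e) * ((real n + 1) powr e * q ^ n)"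
        by (simp add: mult_ac)
      have "norm (\<mu> / (of_nat n * \<mu> + of_rat m) * of_real q ^ n) \<le> K / (real n + 1) * q ^ n"
        unfolding norm_mult norm_power norm_of_real using K(1) K(2)[of n] q by (intro mult_mono) auto
      also have "\<dots> \<le> K * (real n + 1) powr (- 1 - e) * (1 - q) powr (- e)"
        unfolding eq using power_times_Suc_le[OF q assms] K(1) by (intro mult_left_mono) auto
      finally show ?thesis by (simp add: mult_ac)
    qed
    have "norm (T_ev q) \<le> suminf (\<lambda>n. K * (1 - q) powr (- e) * (real n + 1) powr (- 1 - e))"
      unfolding sums_unique[OF T_ev_sums[OF q]]
      using assms by (intro norm_suminf_le bd summable_mult summable_Suc_powr) simp
    also have "\<dots> = K * (1 - q) powr (- e) * ?S"
      using assms by (intro suminf_mult summable_Suc_powr) simp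
    finally show "norm (T_ev q) \<le> K * ?S * (1 - q) powr (- e)" by (simp add: mult_ac)
  qed
qed

text \<open>With \<open>z\<close> the denominator, the numerator of the real part is
  \<open>Re (\<mu> * cnj z) = n * norm \<mu> ^ 2 + m * Re \<mu>\<close>, of order
  \<open>n + 1\<close>, while \<open>norm z ^ 2\<close> is at most of order
  \<open>(n + 1) ^ 2\<close>.\<close>

lemma Re_letter_coeff_ge:
  obtains c where "c > 0" "\<And>n. Re (\<mu> / (of_nat n * \<mu> + of_rat m)) \<ge> c / (real n + 1)"
proof -
  define M where "M = (of_rat m :: real)"
  define A where "A = norm \<mu> + M"
  define a where "a = min (norm \<mu> ^ 2) (M * Re \<mu>)"
  have M: "M > 0" "complex_of_rat m = of_real M" using m by (simp_all add: M_def of_rat_complex)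
  have A: "A > 0" using M norm_ge_zero[of \<mu>] unfolding A_def by linarith
  have a: "a > 0" using M re unfolding a_def by auto
  have "Re (\<mu> / (of_nat n * \<mu> + of_rat m)) \<ge> (a / A ^ 2) / (real n + 1)" for n
  proof -
    let ?z = "of_nat n * \<mu> + of_rat m"
    have z: "norm ?z > 0" using denominator_nonzero[OF re m, of n] by simp
    have "norm ?z \<le> real n * norm \<mu> + M"
      using norm_triangle_ineq[of "of_nat n * \<mu>" "of_rat m"] M by (simp add: norm_mult)
    also have "\<dots> \<le> A * (real n + 1)"
      using M(1) by (simp add: A_def algebra_simps)
    finally have zA: "norm ?z \<le> A * (real n + 1)" .
    have "a * (real n + 1) \<le> real n * norm \<mu> ^ 2 + M * Re \<mu>"
      using mult_left_mono[of a "norm \<mu> ^ 2" "real n"] by (simp add: a_def algebra_simps)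
    also have "\<dots> = Re (\<mu> * cnj ?z)"
      unfolding cmod_power2 by (simp add: M(2) algebra_simps power2_eq_square)
    finally have num: "a * (real n + 1) \<le> Re (\<mu> * cnj ?z)" .
    have "(a / A ^ 2) / (real n + 1) = a * (real n + 1) / (A * (real n + 1)) ^ 2"
      by (simp add: power_mult_distrib power2_eq_square)
    also have "\<dots> \<le> a * (real n + 1) / norm ?z ^ 2"
      using a z zA A by (intro divide_left_mono power_mono mult_pos_pos zero_less_power) auto
    also have "\<dots> \<le> Re (\<mu> * cnj ?z) / norm ?z ^ 2"
      using num by (intro divide_right_mono) auto
    also have "\<dots> = Re (\<mu> / ?z)"
      by (simp add: complex_div_cnj[of \<mu> ?z] Re_divide_of_real flip: of_real_power)
    finally show ?thesis .
  qed
  moreover have "a / A ^ 2 > 0" using a A by simp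
  ultimately show ?thesis using that by blast
qed

text \<open>The real parts of the coefficients are nonnegative and dominate a harmonic series. A
  finite partial sum exceeding \<open>Z\<close> at \<open>q = 1\<close> still does so near 1 by
  continuity, and bounds \<open>Re (T_ev q)\<close> from below.\<close>

lemma T_ev_at_infinity: "filterlim T_ev at_infinity (at_left 1)"
proof -
  obtain c where c: "c > 0" "\<And>n. Re (\<mu> / (of_nat n * \<mu> + of_rat m)) \<ge> c / (real n + 1)"
    using Re_letter_coeff_ge by metis
  let ?S = "\<lambda>N q. \<Sum>n<N. c / (real n + 1) * q ^ n"
  have "eventually (\<lambda>q. Z \<le> Re (T_ev q)) (at_left 1)" for Z
  proof -
    have "\<exists>N. Z < ?S N 1"
    proof (rule ccontr)
      assume "\<not> ?thesis"
      then have "\<And>N. ?S N 1 \<le> Z" by (auto simp: not_less)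
      then have "summable (\<lambda>n. c / (real n + 1))"
        using c(1) by (intro summableI_nonneg_bounded[where x = Z]) auto
      then have "summable (\<lambda>n. inverse c * (c / (real n + 1)))" by (rule summable_mult)
      then have "summable (\<lambda>n. inverse (real (Suc n)))"
        using c(1) by (simp add: field_simps)
      then show False
        using not_summable_harmonic[where ?'a = real] summable_Suc_iff[of "\<lambda>n. inverse (real n)"] by simp
    qed
    then obtain N where N: "Z < ?S N 1" ..
    have "((\<lambda>q. ?S N q) \<longlongrightarrow> ?S N 1) (at_left 1)"
      by (intro tendsto_intros)
    then have "eventually (\<lambda>q. Z < ?S N q) (at_left 1)"
      using N by (rule order_tendstoD(1))
    then show ?thesis
      using eventually_unit_interval
    proof eventually_elim
      case (elim q)
      have "Re (z * of_real q ^ n) = Re z * q ^ n" for z n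
        by (simp flip: of_real_power)
      then have s: "(\<lambda>n. Re (\<mu> / (of_nat n * \<mu> + of_rat m)) * q ^ n) sums Re (T_ev q)"
        using sums_Re[OF T_ev_sums[of q]] elim by (simp only:)
      have nn: "Re (\<mu> / (of_nat n * \<mu> + of_rat m)) \<ge> 0" for n
        using c(2)[of n] c(1) by (meson divide_nonneg_nonneg less_imp_le of_nat_0_le_iff add_nonneg_nonneg order_trans zero_le_one)
      have "?S N q \<le> (\<Sum>n<N. Re (\<mu> / (of_nat n * \<mu> + of_rat m)) * q ^ n)"
        using c elim by (intro sum_mono mult_right_mono) auto
      also have "\<dots> \<le> Re (T_ev q)"
        unfolding sums_unique[OF s] using elim nn
        by (intro sum_le_suminf sums_summable[OF s]) auto
      finally show ?case using elim by simp
    qed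
  qed
  then have "filterlim (\<lambda>q. Re (T_ev q)) at_top (at_left 1)"
    by (simp add: filterlim_at_top)
  then have "filterlim (\<lambda>q. norm (T_ev q)) at_top (at_left 1)"
    by (rule filterlim_at_top_mono) (simp add: complex_Re_le_cmod)
  then show ?thesis by (rule filterlim_norm_at_top_imp_at_infinity)
qed

subsection \<open>Regularised values\<close>

text \<open>Demanding all \<open>N\<close> makes the class stable under multiplication by
  polynomials in \<open>T_ev\<close>, which the cross terms of a product require.\<close>

definition negligible :: "(real \<Rightarrow> complex) \<Rightarrow> bool" where
  "negligible f \<longleftrightarrow> (\<forall>N. ((\<lambda>q. f q * T_ev q ^ N) \<longlongrightarrow> 0) (at_left 1))"

lemma negligible_cong:
  assumes "\<And>q. 0 < q \<Longrightarrow> q < 1 \<Longrightarrow> f q = g q" "negligible g"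
  shows "negligible f"
  unfolding negligible_def
proof
  fix N
  have "eventually (\<lambda>q. g q * T_ev q ^ N = f q * T_ev q ^ N) (at_left 1)"
    using eventually_unit_interval by eventually_elim (simp add: assms(1))
  then show "((\<lambda>q. f q * T_ev q ^ N) \<longlongrightarrow> 0) (at_left 1)"
    by (rule Lim_transform_eventually[rotated]) (use assms(2) in \<open>simp add: negligible_def\<close>)
qed

lemma negligible_zero: "negligible (\<lambda>_. 0)"
  by (simp add: negligible_def)

lemma negligible_add: "negligible f \<Longrightarrow> negligible g \<Longrightarrow> negligible (\<lambda>q. f q + g q)"
  unfolding negligible_def using tendsto_add_zero by (fastforce simp: distrib_right)

lemma negligible_cmult:
  assumes "negligible f"
  shows "negligible (\<lambda>q. c * f q)"
  unfolding negligible_def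
proof
  fix N
  show "((\<lambda>q. c * f q * T_ev q ^ N) \<longlongrightarrow> 0) (at_left 1)"
    using tendsto_mult_right_zero[of "\<lambda>q. f q * T_ev q ^ N" "at_left 1" c] assms
    by (simp add: negligible_def mult.assoc)
qed

lemma negligible_mult:
  assumes "negligible f" "negligible g"
  shows "negligible (\<lambda>q. f q * g q)"
  unfolding negligible_def
proof
  fix N
  have "(f \<longlongrightarrow> 0) (at_left 1)" 
    using spec[OF assms(1)[unfolded negligible_def], of 0] by simp
  moreover have "((\<lambda>q. g q * T_ev q ^ N) \<longlongrightarrow> 0) (at_left 1)" using assms(2) by (simp add: negligible_def)
  ultimately show "((\<lambda>q. f q * g q * T_ev q ^ N) \<longlongrightarrow> 0) (at_left 1)"
    using tendsto_mult_zero by (fastforce simp: mult.assoc)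
qed

lemma negligible_T_mult:
  assumes "negligible f"
  shows "negligible (\<lambda>q. T_ev q * f q)"
  unfolding negligible_def
proof
  fix N
  show "((\<lambda>q. T_ev q * f q * T_ev q ^ N) \<longlongrightarrow> 0) (at_left 1)"
    using spec[OF assms[unfolded negligible_def], of "Suc N"] by (simp add: mult_ac)
qed

lemma negligible_poly_mult:
  assumes "negligible f"
  shows "negligible (\<lambda>q. poly P (T_ev q) * f q)"
proof (induction P)
  case (pCons a P)
  have "negligible (\<lambda>q. a * f q + T_ev q * (poly P (T_ev q) * f q))"
    by (intro negligible_add negligible_cmult negligible_T_mult assms pCons)
  then show ?case by (simp add: algebra_simps)
qed (simp add: negligible_zero)

text \<open>Subtracting the constant coefficient and dividing by \<open>T_ev\<close>, which tends to
  infinity, leaves a polynomial of smaller degree with limit 0 again.\<close>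

lemma poly_T_ev_tendsto_zero_imp:
  assumes "((\<lambda>q. poly P (T_ev q)) \<longlongrightarrow> 0) (at_left 1)"
  shows "P = 0"
  using assms
proof (induction P)
  case (pCons a P)
  have "((\<lambda>q. (poly (pCons a P) (T_ev q) - a) * inverse (T_ev q)) \<longlongrightarrow> (0 - a) * 0) (at_left 1)"
    by (intro tendsto_mult tendsto_diff pCons.prems tendsto_const
        filterlim_compose[OF tendsto_inverse_0 T_ev_at_infinity])
  moreover have "eventually (\<lambda>q. T_ev q \<noteq> 0) (at_left 1)"
    using T_ev_at_infinity by (rule filterlim_at_infinity_imp_eventually_ne)
  then have "eventually (\<lambda>q. (poly (pCons a P) (T_ev q) - a) * inverse (T_ev q) = poly P (T_ev q)) (at_left 1)"
    by eventually_elim simp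
  ultimately have "((\<lambda>q. poly P (T_ev q)) \<longlongrightarrow> 0) (at_left 1)"
    using Lim_transform_eventually by fastforce
  then have P: "P = 0" by (rule pCons.IH)
  then have "((\<lambda>q :: real. a) \<longlongrightarrow> 0) (at_left 1)" using pCons.prems by simp
  then have "a = 0" by (simp add: tendsto_const_iff)
  with P show ?case by simp
qed simp

text \<open>\<open>P\<close> is the asymptotic expansion of the series of \<open>p\<close> in powers
  of \<open>T_ev\<close>. As a relation it can be combined along operations before existence of
  \<open>P\<close> is known.\<close>

definition regularises :: "word_comb \<Rightarrow> complex poly \<Rightarrow> bool" where
  "regularises p P \<longleftrightarrow> negligible (\<lambda>q. ev p q - poly P (T_ev q))"

lemma regularises_unique:
  assumes "regularises p P" "regularises p Q"
  shows "P = Q"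
proof -
  have "negligible (\<lambda>q. (ev p q - poly Q (T_ev q)) + (- 1) * (ev p q - poly P (T_ev q)))"
    using assms unfolding regularises_def by (intro negligible_add negligible_cmult)
  then have "negligible (\<lambda>q. poly (P - Q) (T_ev q))" by (simp add: algebra_simps)
  then have "((\<lambda>q. poly (P - Q) (T_ev q) * T_ev q ^ 0) \<longlongrightarrow> 0) (at_left 1)"
    unfolding negligible_def by blast
  then have "((\<lambda>q. poly (P - Q) (T_ev q)) \<longlongrightarrow> 0) (at_left 1)"
    by simp
  then have "P - Q = 0" by (rule poly_T_ev_tendsto_zero_imp)
  then show ?thesis by simp
qed

lemma regularises_add:
  assumes "v \<in> H1 \<mu>" "w \<in> H1 \<mu>" "regularises v P" "regularises w Q"
  shows "regularises (v + w) (P + Q)"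
  unfolding regularises_def
proof (rule negligible_cong)
  show "negligible (\<lambda>q. (ev v q - poly P (T_ev q)) + (ev w q - poly Q (T_ev q)))"
    using assms(3,4) unfolding regularises_def by (rule negligible_add)
qed (simp add: ev_add assms)

lemma regularises_scale:
  assumes "v \<in> H1 \<mu>" "regularises v P"
  shows "regularises (scale_comb c v) (smult c P)"
  unfolding regularises_def
proof (rule negligible_cong)
  show "negligible (\<lambda>q. c * (ev v q - poly P (T_ev q)))"
    using assms(2) unfolding regularises_def by (rule negligible_cmult)
qed (simp add: ev_scale assms algebra_simps)

lemma regularises_shuffle:
  assumes "v \<in> H1 \<mu>" "w \<in> H1 \<mu>" "regularises v P" "regularises w Q"
  shows "regularises (shuffle v w) (P * Q)"
  unfolding regularises_def
proof (rule negligible_cong)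
  let ?e = "\<lambda>q. ev v q - poly P (T_ev q)" and ?f = "\<lambda>q. ev w q - poly Q (T_ev q)"
  \<comment> \<open>This is the expansion of \<open>(P + e) * (Q + f) - P * Q\<close>.\<close>
  show "negligible (\<lambda>q. ?e q * ?f q + (poly Q (T_ev q) * ?e q + poly P (T_ev q) * ?f q))"
    using assms(3,4) unfolding regularises_def
    by (intro negligible_add negligible_mult negligible_poly_mult)
qed (simp add: ev_shuffle assms algebra_simps)

lemma regularises_letter: "regularises (word [Ly m]) [:0, 1:]"
  by (simp add: regularises_def negligible_zero)

lemma regularises_fast_decay:
  assumes "fast_decay (fps_nth (comb_series \<mu> p))"
  shows "regularises p [:suminf (fps_nth (comb_series \<mu> p)):]"
  unfolding regularises_def negligible_def
proof
  fix N :: nat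
  let ?e = "\<lambda>q. ev p q - poly [:suminf (fps_nth (comb_series \<mu> p)):] (T_ev q)"
  obtain C where C: "\<And>q. 0 < q \<Longrightarrow> q < 1 \<Longrightarrow> norm (?e q) \<le> C * (1 - q) powr (1/4)"
    using abel_fast_decay[OF assms] unfolding ev_def by auto
  \<comment> \<open>Chosen so that the \<open>N\<close>-th power of \<open>T_ev\<close> costs at
    most an exponent 1/8 out of the available 1/4; the \<open>+ 1\<close> covers
    \<open>N = 0\<close>.\<close>
  define d where "d = 1 / (8 * (real N + 1))"
  have d: "0 < d" "d \<le> 1" "real N * d \<le> 1/8" by (auto simp: d_def field_simps)
  obtain B where B: "\<And>q. 0 < q \<Longrightarrow> q < 1 \<Longrightarrow> norm (T_ev q) \<le> B * (1 - q) powr (- d)"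
    using T_ev_le[OF d(1,2)] by blast
  have bound: "norm (?e q * T_ev q ^ N) \<le> C * B ^ N * (1 - q) powr (1/8)" if q: "0 < q" "q < 1" for q
  proof -
    have B0: "B \<ge> 0" using order_trans[OF norm_ge_zero B[OF q]] q by (simp add: zero_le_mult_iff)
    have C0: "C \<ge> 0" using order_trans[OF norm_ge_zero C[OF q]] q by (simp add: zero_le_mult_iff)
    have "norm (?e q * T_ev q ^ N) \<le> (C * (1 - q) powr (1/4)) * (B * (1 - q) powr (- d)) ^ N"
      unfolding norm_mult norm_power using B[OF q] C[OF q] C0 by (intro mult_mono power_mono) auto
    also have "\<dots> = C * B ^ N * ((1 - q) powr (1/4) * ((1 - q) powr (- d)) ^ N)"
      by (simp add: power_mult_distrib)
    also have "(1 - q) powr (1/4) * ((1 - q) powr (- d)) ^ N = (1 - q) powr (1/4 - real N * d)"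
      using q by (simp add: powr_power powr_add[symmetric] mult.commute)
    also have "C * B ^ N * (1 - q) powr (1/4 - real N * d) \<le> C * B ^ N * (1 - q) powr (1/8)"
      using B0 C0 q d by (intro mult_left_mono powr_mono') auto
    finally show ?thesis .
  qed
  have "((\<lambda>q :: real. C * B ^ N * (1 - q) powr (1/8)) \<longlongrightarrow> C * B ^ N * 0) (at_left 1)"
  proof (intro tendsto_mult tendsto_const)
    have "((\<lambda>q :: real. 1 - q) \<longlongrightarrow> 0) (at_left 1)"
      by (auto intro!: tendsto_eq_intros)
    then show "((\<lambda>q :: real. (1 - q) powr (1/8)) \<longlongrightarrow> 0) (at_left 1)"
      by (rule tendsto_zero_powrI[OF _ tendsto_const])
         (use eventually_unit_interval in \<open>auto elim: eventually_mono\<close>)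
  qed
  then have "((\<lambda>q :: real. C * B ^ N * (1 - q) powr (1/8)) \<longlongrightarrow> 0) (at_left 1)" by simp
  then show "((\<lambda>q. ?e q * T_ev q ^ N) \<longlongrightarrow> 0) (at_left 1)"
    by (rule Lim_null_comparison[rotated]) (use eventually_unit_interval bound in \<open>auto elim: eventually_mono\<close>)
qed

lemma regularises_empty: "regularises (word []) [:1:]"
  by (simp add: regularises_def negligible_zero ev_def comb_series_simps)

lemma regularises_admissible:
  "admissible ks ms \<Longrightarrow> regularises (yx_word ks ms) [:zeta_mu \<mu> ks ms:]"
  using regularises_fast_decay[of "yx_word ks ms"] zeta_mu_eq_suminf[OF _ re]
  by (simp add: yx_word_def comb_series_simps)

lemma regularises_special:
  "special_triple ks ms ms' \<Longrightarrow> regularises (yx_word ks ms - yx_word ks ms') [:D_mu \<mu> ks ms ms':]"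
  using regularises_fast_decay[of "yx_word ks ms - yx_word ks ms'"] D_mu_eq_suminf[OF _ re]
  by (simp add: yx_word_def comb_series_simps)

section \<open>Coefficients in \<open>Z_mu\<close> and construction of the regularisation
  map\<close>

lemma closed_over_Z_mu: "closed_over (rat_adjoin \<mu>) (*) (Z_mu \<mu>)"
  unfolding Z_mu_def by (rule closed_over_span_rat_adjoin[OF module_times])

lemma Z_mu_generators:
  "1 \<in> Z_mu \<mu>" "admissible ks ms \<Longrightarrow> zeta_mu \<mu> ks ms \<in> Z_mu \<mu>"
  "special_triple ks ms ms' \<Longrightarrow> D_mu \<mu> ks ms ms' \<in> Z_mu \<mu>"
  unfolding Z_mu_def by (intro subsetD[OF span_over_superset[OF module_times]]; auto)+

lemma regularises_H0:
  assumes "p \<in> H0 \<mu>"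
  shows "\<exists>z\<in>Z_mu \<mu>. regularises p [:z:]"
proof -
  \<comment> \<open>Membership in \<open>H1\<close> is part of the set because additivity of
    \<open>regularises\<close> is available only there, where the series converge.\<close>
  let ?V = "{p \<in> H1 \<mu>. \<exists>z\<in>Z_mu \<mu>. regularises p [:z:]}"
  have "closed_over (rat_adjoin \<mu>) scale_comb ?V"
    unfolding closed_over_def
  proof (intro conjI ballI)
    have "regularises 0 [:0:]"
      by (simp add: regularises_def negligible_zero ev_def comb_series_def lext_zero[OF module_fps_const])
    then show "0 \<in> ?V"
      using closed_overD(1)[OF closed_over_Z_mu] closed_overD(1)[OF closed_over_H1] by blast
  next
    fix v w assume v: "v \<in> ?V" and w: "w \<in> ?V"
    then obtain a b where ab: "a \<in> Z_mu \<mu>" "regularises v [:a:]" "b \<in> Z_mu \<mu>" "regularises w [:b:]" by blast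
    then have "regularises (v + w) [:a + b:]" using regularises_add[of v w "[:a:]" "[:b:]"] v w by simp
    then show "v + w \<in> ?V"
      using v w ab closed_overD(2)[OF closed_over_Z_mu] closed_overD(2)[OF closed_over_H1] by blast
  next
    fix c v assume c: "c \<in> rat_adjoin \<mu>" and v: "v \<in> ?V"
    then obtain a where a: "a \<in> Z_mu \<mu>" "regularises v [:a:]" by blast
    then have "regularises (scale_comb c v) [:c * a:]" using regularises_scale[of v "[:a:]" c] v by simp
    then show "scale_comb c v \<in> ?V"
      using c v a closed_overD(3)[OF closed_over_Z_mu] closed_overD(3)[OF closed_over_H1] by blast
  qed
  moreover have "{word []} \<union> {yx_word ks ms | ks ms. admissible ks ms} \<union>
      {yx_word ks ms - yx_word ks ms' | ks ms ms'. special_triple ks ms ms'} \<subseteq> ?V" (is "?S \<subseteq> _")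
  proof -
    have "?S \<subseteq> H0 \<mu>" unfolding H0_def by (rule span_over_superset[OF module_scale_comb]) simp
    then have "?S \<subseteq> H1 \<mu>" using H0_subset_H1 by blast
    moreover have "\<forall>p\<in>?S. \<exists>z\<in>Z_mu \<mu>. regularises p [:z:]"
      using regularises_empty regularises_admissible regularises_special Z_mu_generators by fast
    ultimately show ?thesis by blast
  qed
  ultimately have "H0 \<mu> \<subseteq> ?V"
    unfolding H0_def by (rule span_over_least)
  then show ?thesis using assms by blast
qed

lemma regularises_H1:
  assumes "p \<in> H1 \<mu>"
  shows "\<exists>P\<in>Z_mu_poly \<mu>. regularises p P"
proof -
  note Z = closed_overD[OF closed_over_Z_mu]
  have "p \<in> generated \<mu> m" using assms H1_eq_generated[OF m] by simp
  then show ?thesis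
  proof induction
    case (base p)
    then obtain z where "z \<in> Z_mu \<mu>" "regularises p [:z:]" using regularises_H0 by blast
    moreover from this have "[:z:] \<in> Z_mu_poly \<mu>"
      using Z(1) by (simp add: Z_mu_poly_def coeff_pCons split: nat.split)
    ultimately show ?case by blast
  next
    case (add p q)
    then obtain P Q where "P \<in> Z_mu_poly \<mu>" "regularises p P" "Q \<in> Z_mu_poly \<mu>" "regularises q Q" by blast
    moreover from this have "P + Q \<in> Z_mu_poly \<mu>" using Z(2) by (simp add: Z_mu_poly_def)
    ultimately show ?case using regularises_add add.hyps H1_eq_generated[OF m] by blast
  next
    case (scale c p)
    then obtain P where "P \<in> Z_mu_poly \<mu>" "regularises p P" by blast
    moreover from this scale.hyps have "smult c P \<in> Z_mu_poly \<mu>" using Z(3) by (simp add: Z_mu_poly_def)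
    ultimately show ?case using regularises_scale scale.hyps H1_eq_generated[OF m] by blast
  next
    case (shuffle p)
    then obtain P where P: "P \<in> Z_mu_poly \<mu>" "regularises p P" by blast
    then have "[:0, 1:] * P \<in> Z_mu_poly \<mu>" using Z(1) by (simp add: Z_mu_poly_def coeff_pCons split: nat.split)
    moreover have "regularises (shuffle (word [Ly m]) p) ([:0, 1:] * P)"
      using shuffle.hyps H1_eq_generated[OF m] P
      by (intro regularises_shuffle regularises_letter word_in_H1 positive_word_letter) auto
    ultimately show ?case by blast
  qed
qed

text \<open>\<open>zeta_sh\<close> is a definite description over dependent generators, so a map
  with the prescribed values must first be exhibited. The constant regularised value depends only on
  the element, not on how it is written, and therefore provides one.\<close>

lemma regularises_zeta_sh:
  assumes "p \<in> H0 \<mu>"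
  shows "regularises p [:zeta_sh \<mu> p:]"
proof -
  let ?gen = "{word []} \<union> {yx_word ks ms | ks ms. admissible ks ms} \<union>
      {yx_word ks ms - yx_word ks ms' | ks ms ms'. special_triple ks ms ms'}"
  define f where "f = restrict (\<lambda>p. THE z. regularises p [:z:]) (H0 \<mu>)"
  have f_eq: "f p = z" if "p \<in> H0 \<mu>" "regularises p [:z:]" for p z
    using that by (auto simp: f_def intro!: the_equality dest: regularises_unique)
  have f: "regularises p [:f p:] \<and> f p \<in> Z_mu \<mu>" if "p \<in> H0 \<mu>" for p
    using regularises_H0[OF that] f_eq[OF that] by auto
  have gen: "?gen \<subseteq> H0 \<mu>" unfolding H0_def by (rule span_over_superset[OF module_scale_comb]) simp
  have H1: "p \<in> H1 \<mu>" if "p \<in> H0 \<mu>" for p using that H0_subset_H1 by blast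
  let ?is = "\<lambda>f. f \<in> H0 \<mu> \<rightarrow>\<^sub>E Z_mu \<mu> \<and>
     linear_over (rat_adjoin \<mu>) scale_comb (*) (H0 \<mu>) f \<and> f (word []) = 1 \<and>
     (\<forall>ks ms. admissible ks ms \<longrightarrow> f (yx_word ks ms) = zeta_mu \<mu> ks ms) \<and>
     (\<forall>ks ms ms'. special_triple ks ms ms' \<longrightarrow> f (yx_word ks ms - yx_word ks ms') = D_mu \<mu> ks ms ms')"
  have "?is f"
  proof (intro conjI allI impI)
    show "f \<in> H0 \<mu> \<rightarrow>\<^sub>E Z_mu \<mu>" using f by (auto simp: f_def)
    show "linear_over (rat_adjoin \<mu>) scale_comb (*) (H0 \<mu>) f"
      unfolding linear_over_def
    proof (intro conjI ballI)
      fix v w assume "v \<in> H0 \<mu>" "w \<in> H0 \<mu>"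
      then show "f (v + w) = f v + f w"
        using regularises_add[of v w "[:f v:]" "[:f w:]"] f H1
        by (intro f_eq closed_overD(2)[OF closed_over_H0]) auto
    next
      fix c v assume "c \<in> rat_adjoin \<mu>" "v \<in> H0 \<mu>"
      then show "f (scale_comb c v) = c * f v"
        using regularises_scale[of v "[:f v:]" c] f H1
        by (intro f_eq closed_overD(3)[OF closed_over_H0]) auto
    qed
    show "f (word []) = 1" using gen regularises_empty by (intro f_eq) blast+
    show "f (yx_word ks ms) = zeta_mu \<mu> ks ms" if "admissible ks ms" for ks ms
      using that gen regularises_admissible by (intro f_eq) blast+
    show "f (yx_word ks ms - yx_word ks ms') = D_mu \<mu> ks ms ms'" if "special_triple ks ms ms'" for ks ms ms'
      using that gen regularises_special by (intro f_eq) blast+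
  qed
  \<comment> \<open>Two candidates agree on the generators, hence on their span, and both take the
    default value off \<open>H0\<close>.\<close>
  moreover have "g = f" if g: "?is g" for g
  proof (rule extensionalityI)
    show "g \<in> extensional (H0 \<mu>)" "f \<in> extensional (H0 \<mu>)"
      using g \<open>?is f\<close> by (auto simp: PiE_def)
    show "g p = f p" if "p \<in> H0 \<mu>" for p
    proof (rule linear_over_unique_span[OF module_scale_comb module_times])
      show "linear_over (rat_adjoin \<mu>) scale_comb (*) (span_over (rat_adjoin \<mu>) scale_comb ?gen) g"
        "linear_over (rat_adjoin \<mu>) scale_comb (*) (span_over (rat_adjoin \<mu>) scale_comb ?gen) f"
        using g \<open>?is f\<close> unfolding H0_def by blast+
      show "closed_over (rat_adjoin \<mu>) scale_comb (span_over (rat_adjoin \<mu>) scale_comb ?gen)"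
        by (rule closed_over_span_rat_adjoin[OF module_scale_comb])
      show "p \<in> span_over (rat_adjoin \<mu>) scale_comb ?gen" using that unfolding H0_def .
      show "g v = f v" if "v \<in> ?gen" for v
        using that g \<open>?is f\<close> by fastforce
    qed simp_all
  qed
  ultimately have "zeta_sh \<mu> = f"
    unfolding zeta_sh_def by (rule the_equality)
  then show ?thesis using f assms by simp
qed

lemma regularisation_exists_unique:
  "\<exists>!\<phi>. \<phi> \<in> H1 \<mu> \<rightarrow>\<^sub>E Z_mu_poly \<mu> \<and>
     linear_over (rat_adjoin \<mu>) scale_comb smult (H1 \<mu>) \<phi> \<and>
     (\<forall>w\<in>H0 \<mu>. \<phi> w = [:zeta_sh \<mu> w:]) \<and>
     \<phi> (word [Ly m]) = [:0, 1:] \<and>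
     (\<forall>v\<in>H1 \<mu>. \<forall>w\<in>H1 \<mu>. \<phi> (shuffle v w) = \<phi> v * \<phi> w)" (is "\<exists>!\<phi>. ?is \<phi>")
proof (rule ex1I)
  \<comment> \<open>Each required property of \<open>f\<close> becomes a statement that a given
    polynomial regularises a given element; \<open>f_eq\<close> then turns it into an
    equation.\<close>
  define f where "f = restrict (\<lambda>p. THE P. regularises p P) (H1 \<mu>)"
  have f_eq: "f p = P" if "p \<in> H1 \<mu>" "regularises p P" for p P
    using that by (auto simp: f_def intro!: the_equality dest: regularises_unique)
  have f: "regularises p (f p) \<and> f p \<in> Z_mu_poly \<mu>" if "p \<in> H1 \<mu>" for p
    using regularises_H1[OF that] f_eq[OF that] by auto
  have y: "word [Ly m] \<in> H1 \<mu>" by (rule word_in_H1[OF positive_word_letter])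
  show f_is: "?is f"
  proof (intro conjI ballI)
    show "f \<in> H1 \<mu> \<rightarrow>\<^sub>E Z_mu_poly \<mu>" using f by (auto simp: f_def)
    show "linear_over (rat_adjoin \<mu>) scale_comb smult (H1 \<mu>) f"
      unfolding linear_over_def
      using f by (auto intro!: f_eq regularises_add regularises_scale intro: closed_overD[OF closed_over_H1])
    show "f w = [:zeta_sh \<mu> w:]" if "w \<in> H0 \<mu>" for w
      using that H0_subset_H1 regularises_zeta_sh by (intro f_eq) auto
    show "f (word [Ly m]) = [:0, 1:]" using y regularises_letter by (rule f_eq)
    show "f (shuffle v w) = f v * f w" if "v \<in> H1 \<mu>" "w \<in> H1 \<mu>" for v w
      using that f by (intro f_eq shuffle_in_H1 regularises_shuffle) auto
  qed
  fix g assume g: "?is g"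
  show "g = f"
  proof (rule extensionalityI)
    show "g \<in> extensional (H1 \<mu>)" "f \<in> extensional (H1 \<mu>)"
      using g f_is by (auto simp: PiE_def)
    show "g p = f p" if "p \<in> H1 \<mu>" for p
    proof -
      \<comment> \<open>Along the generation of \<open>p\<close>, condition (i) settles the base,
        linearity the sums and multiples, and (ii) with (iii) the shuffles with
        \<open>y_m\<close>.\<close>
      from that have "p \<in> generated \<mu> m" using H1_eq_generated[OF m] by simp
      then show ?thesis
      proof induction
        case (base p)
        then show ?case using g f_is by simp
      next
        case (add p q)
        then show ?case using g f_is unfolding linear_over_def H1_eq_generated[OF m] by simp
      next
        case (scale c p)
        then show ?case using g f_is unfolding linear_over_def H1_eq_generated[OF m] by simp
      next
        case (shuffle p)
        then have "p \<in> H1 \<mu>" using H1_eq_generated[OF m] by simp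
        then have "g (shuffle (word [Ly m]) p) = [:0, 1:] * g p" "f (shuffle (word [Ly m]) p) = [:0, 1:] * f p"
          using g f_is y by metis+
        then show ?case using shuffle.IH by simp
      qed
    qed
  qed
qed

end

theorem theorem1p4:
  fixes \<mu> :: complex and m :: rat
  assumes "Re \<mu> > 0" and "m > 0"
  shows "\<exists>!\<phi>. \<phi> \<in> H1 \<mu> \<rightarrow>\<^sub>E Z_mu_poly \<mu> \<and>
     linear_over (rat_adjoin \<mu>) scale_comb smult (H1 \<mu>) \<phi> \<and>
     (\<forall>w\<in>H0 \<mu>. \<phi> w = [:zeta_sh \<mu> w:]) \<and>
     \<phi> (word [Ly m]) = [:0, 1:] \<and>
     (\<forall>v\<in>H1 \<mu>. \<forall>w\<in>H1 \<mu>. \<phi> (shuffle v w) = \<phi> v * \<phi> w)"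
  using assms by (rule regularisation_exists_unique)

end
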